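(* Let $\mathbf{K}$ be a $\mu$-AEC which admits intersections. Let $\lambda>\mathrm{LS}(\mathbf{K})$ be a cardinal. Assume GCH (or at least $\mathrm{SCH}_{\mu,\lambda}$). If $\mathbf{K}$ has a model of cardinality at least $\lambda^+$, then $\mathbf{K}$ has a model of internal size $\lambda$.
   Context: Let $\mu$ be a regular infinite cardinal. A ($\mu$-ary) abstract class is a pair $\mathbf{K}=(K,\le_{\mathbf{K}})$ where $K$ is a class of structures in a fixed vocabulary $\tau=\tau(\mathbf{K})$ whose symbols have arity $<\mu$, and $\le_{\mathbf{K}}$ is a partial order on $K$ that (together with $K$) respects isomorphisms and extends the $\tau$-substructure relation. $UM$ denotes the universe of $M$; the cardinality of $M$ is $|UM|$. $\mathbf{K}$ is regarded as a category whose morphisms $f:M\to N$ are the $\mathbf{K}$-embeddings: isomorphisms of $M$ onto some $f[M]$ with $f[M]\le_{\mathbf{K}}N$. An abstract class $\mathbf{K}$ is a $\mu$-AEC if: (i) Coherence: if $M_0,M_1,M_2\in\mathbf{K}$, $M_0\subseteq M_1\le_{\mathbf{K}}M_2$ and $M_0\le_{\mathbf{K}}M_2$, then $M_0\le_{\mathbf{K}}M_1$. (ii) Chain axioms: if $\langle M_i:i\in I\rangle$ is a $\mu$-directed system in $\mathbf{K}$ (w.r.t. $\le_{\mathbf{K}}$), then $M:=\bigcup_i M_i\in\mathbf{K}$, $M_i\le_{\mathbf{K}}M$ for all $i$, and if $M_i\le_{\mathbf{K}}N$ for all $i$ then $M\le_{\mathbf{K}}N$. (iii) Löwenheim–Skolem–Tarski: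 there is a cardinal $\lambda=\lambda^{<\mu}\ge|\tau(\mathbf{K})|+\mu$ such that for all $M\in\mathbf{K}$ and $A\subseteq UM$ there is $M_0\le_{\mathbf{K}}M$ with $A\subseteq UM_0$ and $|UM_0|\le|A|^{<\mu}+\lambda$. The least such $\lambda$ is $\mathrm{LS}(\mathbf{K})$. $\mathbf{K}$ admits intersections if for any $N\in\mathbf{K}$ and $A\subseteq UN$, the set $\mathrm{cl}^N(A):=\bigcap\{UM: M\le_{\mathbf{K}}N,\ A\subseteq UM\}$ is the universe of a $\le_{\mathbf{K}}$-substructure of $N$. For regular $\lambda$, an object $M$ of a category is $\lambda$-presentable if its covariant hom-functor preserves colimits indexed by $\lambda$-directed posets (posets in which every subset of size $<\lambda$ has an upper bound). The presentability rank $r_{\mathbf{K}}(M)$ is the least regular $\lambda$ such that $M$ is $\lambda$-presentable in the category $\mathbf{K}$. The internal size is $|M|_{\mathbf{K}}:=\chi$ if $r_{\mathbf{K}}(M)=\chi^+$, and $|M|_{\mathbf{K}}:=r_{\mathbf{K}}(M)$ if $r_{\mathbf{K}}(M)$ is a limit cardinal. A cardinal $\chi\ge\mu$ is almost $\mu$-closed if $\theta^{<\mu}\le\chi$ for all cardinals $\theta<\chi$. $\mathrm{SCH}_{\mu,\lambda}$ is the statement: there exists a set $S\subseteq\lambda$ of cardinals, all $\ge\mu$, that is unbounded in $\lambda$ (as a subset of the ordinal $\lambda$: for every ordinal $\alpha<\lambda$ there is $\chi\in S$ with $\alpha\le\chi$) and such that every $\chi\in S$ is almost $\mu$-closed. 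*)

theory Defs
  imports Main "HOL-Library.FuncSet"
begin

unbundle cardinal_syntax

section \<open>Universe and cardinals\<close>

text \<open>
  The set-theoretic universe is a type of (strongly) inaccessible cardinality. The sets of the
  paper are the small sets, those of cardinality less than that of the type, and the classes are
  arbitrary sets of structures with small universe. A cardinal (of the universe) is a cardinal
  order in the sense of the library whose field is small; cardinals are compared by \<open>\<le>o\<close>,
  \<open><o\<close>, \<open>=o\<close>.
\<close>

definition inaccessible_type :: "'u itself \<Rightarrow> bool" where
  "inaccessible_type _ \<longleftrightarrow>
     |UNIV :: nat set| <o |UNIV :: 'u set| \<and>
     regularCard |UNIV :: 'u set| \<and>
     (\<forall>A :: 'u set. |A| <o |UNIV :: 'u set| \<longrightarrow> |Pow A| <o |UNIV :: 'u set| )"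

definition small :: "'u set \<Rightarrow> bool" where
  "small A \<longleftrightarrow> |A| <o |UNIV :: 'u set|"

definition cardinal :: "'u rel \<Rightarrow> bool" where
  "cardinal \<kappa> \<longleftrightarrow> Card_order \<kappa> \<and> small (Field \<kappa>)"

definition regular_cardinal :: "'u rel \<Rightarrow> bool" where
  "regular_cardinal \<kappa> \<longleftrightarrow> cardinal \<kappa> \<and> infinite (Field \<kappa>) \<and> regularCard \<kappa>"

definition limit_cardinal :: "'u rel \<Rightarrow> bool" where
  "limit_cardinal \<kappa> \<longleftrightarrow> cardinal \<kappa> \<and> infinite (Field \<kappa>) \<and>
     \<not> (\<exists>\<chi> :: 'u rel. cardinal \<chi> \<and> \<kappa> =o cardSuc \<chi>)"

text \<open>
  \<open>\<theta>\<^sup><\<^sup>\<mu>\<close> is the number of functions into \<open>\<theta>\<close> whose domain is an ordinal below \<open>\<mu>\<close>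
  (a proper initial segment \<open>underS \<mu> \<alpha>\<close> of \<open>\<mu>\<close>). For infinite \<open>\<mu>\<close> and \<open>\<theta> \<ge> 2\<close> this is the
  supremum of the \<open>\<theta>\<^sup>\<nu>\<close> over the cardinals \<open>\<nu> < \<mu>\<close>.
\<close>

definition cpow_less :: "'v rel \<Rightarrow> 'u rel \<Rightarrow> ('u \<times> ('u \<Rightarrow> 'v)) rel" where
  "cpow_less \<theta> \<mu> = |SIGMA \<alpha> : Field \<mu>. Func (underS \<mu> \<alpha>) (Field \<theta>)|"

definition almost_closed :: "'u rel \<Rightarrow> 'u rel \<Rightarrow> bool" where
  "almost_closed \<mu> \<chi> \<longleftrightarrow> cardinal \<chi> \<and> \<mu> \<le>o \<chi> \<and>
     (\<forall>\<theta> :: 'u rel. cardinal \<theta> \<and> \<theta> <o \<chi> \<longrightarrow> cpow_less \<theta> \<mu> \<le>o \<chi>)"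

text \<open>Unboundedness is tested on all ordinals \<open>\<alpha> < \<lambda>\<close>, that is, on well-orders.\<close>

definition SCH :: "'u rel \<Rightarrow> 'u rel \<Rightarrow> bool" where
  "SCH \<mu> lam \<longleftrightarrow> (\<exists>S :: 'u rel set.
     (\<forall>\<chi>\<in>S. cardinal \<chi> \<and> \<chi> <o lam \<and> \<mu> \<le>o \<chi>) \<and>
     (\<forall>\<alpha> :: 'u rel. Well_order \<alpha> \<and> \<alpha> <o lam \<longrightarrow> (\<exists>\<chi>\<in>S. \<alpha> \<le>o \<chi>)) \<and>
     (\<forall>\<chi>\<in>S. almost_closed \<mu> \<chi>))"

definition GCH :: "'u itself \<Rightarrow> bool" where
  "GCH _ \<longleftrightarrow>
     (\<forall>\<kappa> :: 'u rel. cardinal \<kappa> \<and> infinite (Field \<kappa>) \<longrightarrow> |Pow (Field \<kappa>)| =o cardSuc \<kappa>)"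


section \<open>Structures\<close>

text \<open>
  The arity of a symbol is given as a set of argument positions; tuples are extensional functions
  on that set.
\<close>

record 'u vocabulary =
  fun_syms :: "'u set"
  rel_syms :: "'u set"
  arity :: "'u \<Rightarrow> 'u set"

definition syms :: "'u vocabulary \<Rightarrow> 'u set" where
  "syms \<tau> = fun_syms \<tau> \<union> rel_syms \<tau>"

definition wf_vocabulary :: "'u rel \<Rightarrow> 'u vocabulary \<Rightarrow> bool" where
  "wf_vocabulary \<mu> \<tau> \<longleftrightarrow> small (syms \<tau>) \<and> fun_syms \<tau> \<inter> rel_syms \<tau> = {} \<and>
     (\<forall>s\<in>syms \<tau>. |arity \<tau> s| <o \<mu>)"

record 'u struct =
  univ :: "'u set"
  fun_of :: "'u \<Rightarrow> ('u \<Rightarrow> 'u) \<Rightarrow> 'u"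
  rel_of :: "'u \<Rightarrow> ('u \<Rightarrow> 'u) set"

abbreviation tuples :: "'u vocabulary \<Rightarrow> 'u \<Rightarrow> 'u set \<Rightarrow> ('u \<Rightarrow> 'u) set" where
  "tuples \<tau> s A \<equiv> arity \<tau> s \<rightarrow>\<^sub>E A"

text \<open>
  Outside the vocabulary and the universe the interpretation is fixed, so that equality of
  structures is the intended one.
\<close>

definition is_structure :: "'u vocabulary \<Rightarrow> 'u struct \<Rightarrow> bool" where
  "is_structure \<tau> M \<longleftrightarrow> small (univ M) \<and>
     (\<forall>s\<in>fun_syms \<tau>. fun_of M s \<in> tuples \<tau> s (univ M) \<rightarrow>\<^sub>E univ M) \<and>
     (\<forall>s. s \<notin> fun_syms \<tau> \<longrightarrow> fun_of M s = (\<lambda>_. undefined)) \<and>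
     (\<forall>s\<in>rel_syms \<tau>. rel_of M s \<subseteq> tuples \<tau> s (univ M)) \<and>
     (\<forall>s. s \<notin> rel_syms \<tau> \<longrightarrow> rel_of M s = {})"

definition substructure :: "'u vocabulary \<Rightarrow> 'u struct \<Rightarrow> 'u struct \<Rightarrow> bool" where
  "substructure \<tau> M N \<longleftrightarrow> is_structure \<tau> M \<and> is_structure \<tau> N \<and> univ M \<subseteq> univ N \<and>
     (\<forall>s\<in>fun_syms \<tau>. \<forall>x\<in>tuples \<tau> s (univ M). fun_of M s x = fun_of N s x) \<and>
     (\<forall>s\<in>rel_syms \<tau>. rel_of M s = rel_of N s \<inter> tuples \<tau> s (univ M))"

definition isomorphism ::
    "'u vocabulary \<Rightarrow> ('u \<Rightarrow> 'u) \<Rightarrow> 'u struct \<Rightarrow> 'u struct \<Rightarrow> bool" where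
  "isomorphism \<tau> f M N \<longleftrightarrow> is_structure \<tau> M \<and> is_structure \<tau> N \<and>
     bij_betw f (univ M) (univ N) \<and>
     (\<forall>s\<in>fun_syms \<tau>. \<forall>x\<in>tuples \<tau> s (univ M).
        f (fun_of M s x) = fun_of N s (compose (arity \<tau> s) f x)) \<and>
     (\<forall>s\<in>rel_syms \<tau>. \<forall>x\<in>tuples \<tau> s (univ M).
        x \<in> rel_of M s \<longleftrightarrow> compose (arity \<tau> s) f x \<in> rel_of N s)"

text \<open>
  The union of a \<open>\<mu>\<close>-directed system of structures. By directedness every tuple of elements of
  the union lies in some member, and the value there does not depend on the member.
\<close>

definition union_struct ::
    "'u vocabulary \<Rightarrow> 'i set \<Rightarrow> ('i \<Rightarrow> 'u struct) \<Rightarrow> 'u struct" where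
  "union_struct \<tau> I M =
     \<lparr> univ = (\<Union>i\<in>I. univ (M i)),
       fun_of = (\<lambda>s x. if s \<in> fun_syms \<tau> \<and> x \<in> tuples \<tau> s (\<Union>i\<in>I. univ (M i))
                       then fun_of (M (SOME i. i \<in> I \<and> x \<in> tuples \<tau> s (univ (M i)))) s x
                       else undefined),
       rel_of = (\<lambda>s. \<Union>i\<in>I. rel_of (M i) s) \<rparr>"


section \<open>Abstract classes\<close>

record 'u aclass =
  voc :: "'u vocabulary"
  models :: "'u struct set"
  le :: "'u struct \<Rightarrow> 'u struct \<Rightarrow> bool"

definition abstract_class :: "'u rel \<Rightarrow> 'u aclass \<Rightarrow> bool" where
  "abstract_class \<mu> K \<longleftrightarrow>
     wf_vocabulary \<mu> (voc K) \<and>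
     (\<forall>M\<in>models K. is_structure (voc K) M) \<and>
     (\<forall>M N. le K M N \<longrightarrow> M \<in> models K \<and> N \<in> models K \<and> substructure (voc K) M N) \<and>
     (\<forall>M\<in>models K. le K M M) \<and>
     (\<forall>M N. le K M N \<and> le K N M \<longrightarrow> M = N) \<and>
     (\<forall>M N P. le K M N \<and> le K N P \<longrightarrow> le K M P) \<and>
     (\<forall>f M M'. M \<in> models K \<and> isomorphism (voc K) f M M' \<longrightarrow> M' \<in> models K) \<and>
     (\<forall>f M N M' N'. le K M N \<and> isomorphism (voc K) f N N' \<and> isomorphism (voc K) f M M'
        \<longrightarrow> le K M' N')"

definition directed_poset :: "'k rel \<Rightarrow> 'i set \<Rightarrow> 'i rel \<Rightarrow> bool" where
  "directed_poset \<kappa> I r \<longleftrightarrow> partial_order_on I r \<and>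
     (\<forall>X\<subseteq>I. |X| <o \<kappa> \<longrightarrow> (\<exists>u\<in>I. \<forall>x\<in>X. (x, u) \<in> r))"

definition directed_system ::
    "'u rel \<Rightarrow> 'u aclass \<Rightarrow> 'u set \<Rightarrow> 'u rel \<Rightarrow> ('u \<Rightarrow> 'u struct) \<Rightarrow> bool" where
  "directed_system \<mu> K I r M \<longleftrightarrow> small I \<and> directed_poset \<mu> I r \<and>
     (\<forall>i\<in>I. M i \<in> models K) \<and> (\<forall>(i, j)\<in>r. le K (M i) (M j))"

definition coherence :: "'u aclass \<Rightarrow> bool" where
  "coherence K \<longleftrightarrow> (\<forall>M0\<in>models K. \<forall>M1\<in>models K. \<forall>M2\<in>models K.
     substructure (voc K) M0 M1 \<and> le K M1 M2 \<and> le K M0 M2 \<longrightarrow> le K M0 M1)"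

definition chain_axioms :: "'u rel \<Rightarrow> 'u aclass \<Rightarrow> bool" where
  "chain_axioms \<mu> K \<longleftrightarrow> (\<forall>I r M. directed_system \<mu> K I r M \<longrightarrow>
     union_struct (voc K) I M \<in> models K \<and>
     (\<forall>i\<in>I. le K (M i) (union_struct (voc K) I M)) \<and>
     (\<forall>N\<in>models K. (\<forall>i\<in>I. le K (M i) N) \<longrightarrow> le K (union_struct (voc K) I M) N))"

definition LST_cardinal :: "'u rel \<Rightarrow> 'u aclass \<Rightarrow> 'u rel \<Rightarrow> bool" where
  "LST_cardinal \<mu> K lam \<longleftrightarrow> cardinal lam \<and> lam =o cpow_less lam \<mu> \<and>
     |syms (voc K)| +c \<mu> \<le>o lam \<and>
     (\<forall>M\<in>models K. \<forall>A\<subseteq>univ M. \<exists>M0. le K M0 M \<and> A \<subseteq> univ M0 \<and>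
        |univ M0| \<le>o cpow_less |A| \<mu> +c lam)"

definition mu_AEC :: "'u rel \<Rightarrow> 'u aclass \<Rightarrow> bool" where
  "mu_AEC \<mu> K \<longleftrightarrow> abstract_class \<mu> K \<and> coherence K \<and> chain_axioms \<mu> K \<and>
     (\<exists>lam. LST_cardinal \<mu> K lam)"

text \<open>
  \<open>LS(K)\<close> is determined only up to \<open>=o\<close>, hence a predicate; likewise for the presentability rank
  and the internal size.
\<close>

definition is_LS :: "'u rel \<Rightarrow> 'u aclass \<Rightarrow> 'u rel \<Rightarrow> bool" where
  "is_LS \<mu> K lam \<longleftrightarrow> LST_cardinal \<mu> K lam \<and> (\<forall>lam'. LST_cardinal \<mu> K lam' \<longrightarrow> lam \<le>o lam')"

definition cl :: "'u aclass \<Rightarrow> 'u struct \<Rightarrow> 'u set \<Rightarrow> 'u set" where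
  "cl K N A = \<Inter>{univ M | M. le K M N \<and> A \<subseteq> univ M}"

definition admits_intersections :: "'u aclass \<Rightarrow> bool" where
  "admits_intersections K \<longleftrightarrow>
     (\<forall>N\<in>models K. \<forall>A\<subseteq>univ N. \<exists>M. le K M N \<and> univ M = cl K N A)"


section \<open>Concrete categories and directed colimits\<close>

text \<open>
  Both categories involved, \<open>K\<close> and the category of sets, consist of functions between carrier
  sets; morphisms are extensional functions, composition is \<open>compose\<close>.
\<close>

record ('o, 'v) ccat =
  Ob :: "'o set"
  Car :: "'o \<Rightarrow> 'v set"
  Mor :: "'o \<Rightarrow> 'o \<Rightarrow> ('v \<Rightarrow> 'v) set"

definition diagram ::
    "('o, 'v) ccat \<Rightarrow> 'i set \<Rightarrow> 'i rel \<Rightarrow> ('i \<Rightarrow> 'o) \<Rightarrow> ('i \<Rightarrow> 'i \<Rightarrow> 'v \<Rightarrow> 'v) \<Rightarrow> bool" where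
  "diagram C I r D d \<longleftrightarrow>
     (\<forall>i\<in>I. D i \<in> Ob C) \<and>
     (\<forall>(i, j)\<in>r. d i j \<in> Mor C (D i) (D j)) \<and>
     (\<forall>i\<in>I. d i i = restrict id (Car C (D i))) \<and>
     (\<forall>i j k. (i, j) \<in> r \<and> (j, k) \<in> r \<longrightarrow> compose (Car C (D i)) (d j k) (d i j) = d i k)"

definition cocone ::
    "('o, 'v) ccat \<Rightarrow> 'i set \<Rightarrow> 'i rel \<Rightarrow> ('i \<Rightarrow> 'o) \<Rightarrow> ('i \<Rightarrow> 'i \<Rightarrow> 'v \<Rightarrow> 'v) \<Rightarrow>
       'o \<Rightarrow> ('i \<Rightarrow> 'v \<Rightarrow> 'v) \<Rightarrow> bool" where
  "cocone C I r D d X c \<longleftrightarrow>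
     X \<in> Ob C \<and>
     (\<forall>i\<in>I. c i \<in> Mor C (D i) X) \<and>
     (\<forall>(i, j)\<in>r. compose (Car C (D i)) (c j) (d i j) = c i)"

definition colimit ::
    "('o, 'v) ccat \<Rightarrow> 'i set \<Rightarrow> 'i rel \<Rightarrow> ('i \<Rightarrow> 'o) \<Rightarrow> ('i \<Rightarrow> 'i \<Rightarrow> 'v \<Rightarrow> 'v) \<Rightarrow>
       'o \<Rightarrow> ('i \<Rightarrow> 'v \<Rightarrow> 'v) \<Rightarrow> bool" where
  "colimit C I r D d X c \<longleftrightarrow>
     cocone C I r D d X c \<and>
     (\<forall>Y e. cocone C I r D d Y e \<longrightarrow>
        (\<exists>!h. h \<in> Mor C X Y \<and> (\<forall>i\<in>I. compose (Car C (D i)) h (c i) = e i)))"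

text \<open>
  The category of sets, represented on a type \<open>'v\<close> at least as large as \<open>'u\<close>, with objects
  the subsets of \<open>'v\<close> that are small relative to \<open>'u\<close>. The hom-functors of \<open>K\<close> take values in
  the instance \<open>'v = 'u \<Rightarrow> 'u\<close>.
\<close>

definition set_cat :: "'u itself \<Rightarrow> ('v set, 'v) ccat" where
  "set_cat _ = \<lparr> Ob = {A. |A| <o |UNIV :: 'u set| }, Car = (\<lambda>A. A), Mor = (\<lambda>A B. A \<rightarrow>\<^sub>E B) \<rparr>"

definition K_embedding :: "'u aclass \<Rightarrow> ('u \<Rightarrow> 'u) \<Rightarrow> 'u struct \<Rightarrow> 'u struct \<Rightarrow> bool" where
  "K_embedding K f M N \<longleftrightarrow> M \<in> models K \<and> N \<in> models K \<and> f \<in> extensional (univ M) \<and>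
     (\<exists>M'. isomorphism (voc K) f M M' \<and> le K M' N)"

definition cat_of :: "'u aclass \<Rightarrow> ('u struct, 'u) ccat" where
  "cat_of K = \<lparr> Ob = models K, Car = univ, Mor = (\<lambda>M N. {f. K_embedding K f M N}) \<rparr>"

text \<open>The action of the covariant hom-functor \<open>Mor C M -\<close> on a morphism \<open>g\<close> out of \<open>X\<close>.\<close>

definition hom_map ::
    "('o, 'v) ccat \<Rightarrow> 'o \<Rightarrow> 'o \<Rightarrow> ('v \<Rightarrow> 'v) \<Rightarrow> ('v \<Rightarrow> 'v) \<Rightarrow> 'v \<Rightarrow> 'v" where
  "hom_map C M X g = (\<lambda>f\<in>Mor C M X. compose (Car C M) g f)"

definition presentable :: "'u rel \<Rightarrow> ('o, 'u) ccat \<Rightarrow> 'o \<Rightarrow> bool" where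
  "presentable \<kappa> C M \<longleftrightarrow> M \<in> Ob C \<and>
     (\<forall>(I :: 'u set) r D d X c.
        small I \<and> directed_poset \<kappa> I r \<and> diagram C I r D d \<and> colimit C I r D d X c \<longrightarrow>
        colimit (set_cat TYPE('u)) I r
          (\<lambda>i. Mor C M (D i)) (\<lambda>i j. hom_map C M (D i) (d i j))
          (Mor C M X) (\<lambda>i. hom_map C M (D i) (c i)))"

definition has_presentability_rank :: "'u aclass \<Rightarrow> 'u struct \<Rightarrow> 'u rel \<Rightarrow> bool" where
  "has_presentability_rank K M \<kappa> \<longleftrightarrow>
     regular_cardinal \<kappa> \<and> presentable \<kappa> (cat_of K) M \<and>
     (\<forall>\<kappa>'. regular_cardinal \<kappa>' \<and> presentable \<kappa>' (cat_of K) M \<longrightarrow> \<kappa> \<le>o \<kappa>')"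

definition has_internal_size :: "'u aclass \<Rightarrow> 'u struct \<Rightarrow> 'u rel \<Rightarrow> bool" where
  "has_internal_size K M \<chi> \<longleftrightarrow> cardinal \<chi> \<and>
     (\<exists>\<rho>. has_presentability_rank K M \<rho> \<and>
        (\<rho> =o cardSuc \<chi> \<or> limit_cardinal \<rho> \<and> \<chi> =o \<rho>))"

end

theory Submission
  imports Defs
begin

text \<open>
  A model generated by fewer than \<open>\<kappa>\<close> elements is \<open>\<kappa>\<close>-presentable, for regular \<open>\<kappa> \<ge> \<mu>\<close>, because a
  \<open>\<kappa>\<close>-directed colimit is the union of the images of its cocone and closures are preserved by
  embeddings. Conversely a model is the \<open>\<kappa>\<close>-directed union of the closures of its subsets of size
  less than \<open>\<kappa>\<close>, so a \<open>\<kappa>\<close>-presentable model is one of these closures. Hence a model has internal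
  size \<open>lam\<close> as soon as it is generated by \<open>lam\<close> elements and by no fewer.

  Let \<open>N\<close> have size at least \<open>lam\<^sup>+\<close>. If fewer than \<open>lam\<close> elements always have a closure of size less
  than \<open>lam\<close>, then any \<open>lam\<close> elements of \<open>N\<close> generate such a model. This covers \<open>SCH\<close>, and singular
  \<open>lam\<close> under \<open>GCH\<close>, where \<open>\<theta>\<close> elements have a closure of size at most \<open>(\<theta> + LS)\<^sup>+\<close>. If \<open>lam\<close> is
  regular, \<open>GCH\<close> still bounds these closures by \<open>lam\<close>, so they are proper in \<open>N\<close>, and one picks
  \<open>lam\<close> elements successively, each outside the closure of the preceding ones.
\<close>

section \<open>Structures and isomorphisms\<close>

text \<open>Both structures interpret the symbols as \<open>N\<close> does. This supplies the
  substructure premise of coherence.\<close>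

lemma substructure_of_subset:
  assumes "substructure \<tau> P N" "substructure \<tau> Q N" "univ P \<subseteq> univ Q"
  shows "substructure \<tau> P Q"
proof -
  have t: "x \<in> tuples \<tau> s (univ Q)" if "x \<in> tuples \<tau> s (univ P)" for x s
    using that assms(3) by (auto simp: PiE_iff)
  show ?thesis
    using assms t unfolding substructure_def by fastforce
qed

section \<open>Tuples along a map and its inverse\<close>

lemma compose_in_tuples:
  assumes "x \<in> tuples \<tau> s A" "f ` A \<subseteq> B"
  shows "compose (arity \<tau> s) f x \<in> tuples \<tau> s B"
  using assms by (auto simp: compose_def PiE_iff)

lemma compose_cong_on_tuples:
  assumes "x \<in> tuples \<tau> s A" "\<And>a. a \<in> A \<Longrightarrow> f a = g a"
  shows "compose (arity \<tau> s) f x = compose (arity \<tau> s) g x"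
  using assms by (auto simp: compose_def PiE_iff restrict_def)

lemma compose_inv_into_tuples:
  assumes "x \<in> tuples \<tau> s (f ` A)"
  shows "compose (arity \<tau> s) f (compose (arity \<tau> s) (inv_into A f) x) = x"
  using assms
  by (intro ext) (auto simp: compose_def PiE_iff f_inv_into_f extensional_def restrict_def)

lemma inv_into_compose_tuples:
  assumes "x \<in> tuples \<tau> s A" "inj_on f A"
  shows "compose (arity \<tau> s) (inv_into A f) (compose (arity \<tau> s) f x) = x"
  using assms
  by (intro ext) (auto simp: compose_def PiE_iff inv_into_f_f extensional_def restrict_def)

lemma fun_of_closed:
  assumes "is_structure \<tau> M" "s \<in> fun_syms \<tau>" "x \<in> tuples \<tau> s (univ M)"
  shows "fun_of M s x \<in> univ M"
  using assms unfolding is_structure_def by (blast dest: PiE_mem)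

section \<open>Isomorphisms and transport of structure\<close>

lemma isomorphism_univ: "isomorphism \<tau> f M N \<Longrightarrow> univ N = f ` univ M"
  and isomorphism_inj: "isomorphism \<tau> f M N \<Longrightarrow> inj_on f (univ M)"
  by (auto simp: isomorphism_def bij_betw_def)

text \<open>Isomorphisms ignore values off the universe, which allows passing between plain
  composites and the extensional maps that serve as morphisms.\<close>

lemma isomorphism_cong:
  assumes "isomorphism \<tau> f M N" and eq: "\<And>a. a \<in> univ M \<Longrightarrow> f a = g a"
  shows "isomorphism \<tau> g M N"
proof -
  have "bij_betw g (univ M) (univ N)"
    using assms bij_betw_cong[of "univ M" f g "univ N"] by (simp add: isomorphism_def)
  moreover have "g (fun_of M s x) = fun_of N s (compose (arity \<tau> s) g x)"
    if "s \<in> fun_syms \<tau>" "x \<in> tuples \<tau> s (univ M)" for s x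
    using that assms(1) fun_of_closed[of \<tau> M s x] eq[of "fun_of M s x"]
      compose_cong_on_tuples[OF that(2) eq]
    unfolding isomorphism_def by auto
  moreover have "x \<in> rel_of M s \<longleftrightarrow> compose (arity \<tau> s) g x \<in> rel_of N s"
    if "s \<in> rel_syms \<tau>" "x \<in> tuples \<tau> s (univ M)" for s x
    using that assms(1) compose_cong_on_tuples[OF that(2) eq]
    unfolding isomorphism_def by auto
  ultimately show ?thesis using assms(1) by (simp add: isomorphism_def)
qed

lemma isomorphism_id: "is_structure \<tau> M \<Longrightarrow> isomorphism \<tau> id M M"
  by (auto simp: isomorphism_def compose_def PiE_iff extensional_restrict
      intro!: arg_cong[where f = "fun_of M _"])

lemma isomorphism_comp:
  assumes f: "isomorphism \<tau> f M N" and g: "isomorphism \<tau> g N P"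
  shows "isomorphism \<tau> (g \<circ> f) M P"
proof -
  have t: "compose (arity \<tau> s) f x \<in> tuples \<tau> s (univ N)"
    if "x \<in> tuples \<tau> s (univ M)" for s x
    using compose_in_tuples[OF that] isomorphism_univ[OF f] by auto
  have c: "compose (arity \<tau> s) (g \<circ> f) x = compose (arity \<tau> s) g (compose (arity \<tau> s) f x)" for s x
    by (auto simp: compose_def restrict_def)
  show ?thesis
    using f g t bij_betw_trans[of f "univ M" "univ N" g "univ P"]
    unfolding isomorphism_def c by auto
qed

lemma isomorphism_inv:
  assumes f: "isomorphism \<tau> f M N"
  shows "isomorphism \<tau> (inv_into (univ M) f) N M"
proof -
  let ?g = "inv_into (univ M) f"
  note N = isomorphism_univ[OF f] and inj = isomorphism_inj[OF f]
  have t: "compose (arity \<tau> s) ?g x \<in> tuples \<tau> s (univ M)"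
    "compose (arity \<tau> s) f (compose (arity \<tau> s) ?g x) = x"
    if "x \<in> tuples \<tau> s (univ N)" for s x
    using that compose_in_tuples[of x \<tau> s "univ N" ?g "univ M"] compose_inv_into_tuples[of x \<tau> s f "univ M"]
    by (simp_all add: N image_subset_iff inv_into_into)
  have "?g (fun_of N s x) = fun_of M s (compose (arity \<tau> s) ?g x)"
    if s: "s \<in> fun_syms \<tau>" "x \<in> tuples \<tau> s (univ N)" for s x
  proof -
    have "f (fun_of M s (compose (arity \<tau> s) ?g x)) = fun_of N s x"
      using f s t[OF s(2)] unfolding isomorphism_def by auto
    moreover have "fun_of M s (compose (arity \<tau> s) ?g x) \<in> univ M"
      using f s t[OF s(2)] fun_of_closed unfolding isomorphism_def by metis
    ultimately show ?thesis using inj by (metis inv_into_f_f)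
  qed
  moreover have "x \<in> rel_of N s \<longleftrightarrow> compose (arity \<tau> s) ?g x \<in> rel_of M s"
    if s: "s \<in> rel_syms \<tau>" "x \<in> tuples \<tau> s (univ N)" for s x
    using f s t[OF s(2)] unfolding isomorphism_def by auto
  ultimately show ?thesis
    using f bij_betw_inv_into[of f "univ M" "univ N"] unfolding isomorphism_def by auto
qed

lemma small_image: "small A \<Longrightarrow> small (f ` A)" for A :: "'u set" and f :: "'u \<Rightarrow> 'u"
  unfolding small_def by (rule ordLeq_ordLess_trans[OF card_of_image])

text \<open>Transport of structure along an injection. The isomorphism axioms speak about an image
  model only once it exists as a structure; this provides it.\<close>

lemma isomorphic_copy:
  assumes P: "is_structure \<tau> P" and inj: "inj_on f (univ P)"
    and disj: "fun_syms \<tau> \<inter> rel_syms \<tau> = {}"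
  obtains Q where "isomorphism \<tau> f P Q"
proof -
  let ?U = "f ` univ P"
  let ?g = "inv_into (univ P) f"
  \<comment> \<open>Functions are conjugated by \<open>f\<close> and relations pushed forward;
    elsewhere the values are the defaults fixed by \<open>is_structure\<close>.\<close>
  define Q where "Q = \<lparr> univ = ?U,
     fun_of = (\<lambda>s y. if s \<in> fun_syms \<tau> \<and> y \<in> tuples \<tau> s ?U
                     then f (fun_of P s (compose (arity \<tau> s) ?g y)) else undefined),
     rel_of = (\<lambda>s. if s \<in> rel_syms \<tau> then compose (arity \<tau> s) f ` rel_of P s else {}) \<rparr>"
  have gt: "compose (arity \<tau> s) ?g y \<in> tuples \<tau> s (univ P)" if "y \<in> tuples \<tau> s ?U" for s y
    using that compose_in_tuples[of y \<tau> s ?U ?g "univ P"] by (simp add: image_subset_iff inv_into_into)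
  have relP: "rel_of P s \<subseteq> tuples \<tau> s (univ P)" if "s \<in> rel_syms \<tau>" for s
    using P that unfolding is_structure_def by auto
  have "is_structure \<tau> Q"
    unfolding is_structure_def
  proof (intro conjI ballI allI impI)
    show "small (univ Q)" using P small_image by (auto simp: Q_def is_structure_def)
    show "fun_of Q s \<in> tuples \<tau> s (univ Q) \<rightarrow>\<^sub>E univ Q" if "s \<in> fun_syms \<tau>" for s
      by (intro PiE_I) (use that gt fun_of_closed[OF P that] in \<open>simp_all add: Q_def\<close>)
    show "fun_of Q s = (\<lambda>_. undefined)" if "s \<notin> fun_syms \<tau>" for s
      using that by (auto simp: Q_def)
    show "rel_of Q s \<subseteq> tuples \<tau> s (univ Q)" if "s \<in> rel_syms \<tau>" for s
      using that relP[OF that] compose_in_tuples[of _ \<tau> s "univ P" f ?U]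
      by (simp add: Q_def image_subset_iff del: PiE_iff) blast
    show "rel_of Q s = {}" if "s \<notin> rel_syms \<tau>" for s
      using that by (auto simp: Q_def)
  qed
  moreover have "f (fun_of P s x) = fun_of Q s (compose (arity \<tau> s) f x)"
    if "s \<in> fun_syms \<tau>" "x \<in> tuples \<tau> s (univ P)" for s x
    using that inv_into_compose_tuples[OF that(2) inj] compose_in_tuples[OF that(2), of f ?U]
    by (simp add: Q_def)
  moreover have "x \<in> rel_of P s \<longleftrightarrow> compose (arity \<tau> s) f x \<in> rel_of Q s"
    if s: "s \<in> rel_syms \<tau>" "x \<in> tuples \<tau> s (univ P)" for s x
  proof
    assume "compose (arity \<tau> s) f x \<in> rel_of Q s"
    then obtain z where z: "z \<in> rel_of P s" "compose (arity \<tau> s) f x = compose (arity \<tau> s) f z"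
      using s(1) by (auto simp: Q_def)
    then have "x = z"
      using inv_into_compose_tuples[OF s(2) inj] inv_into_compose_tuples[OF _ inj, of z \<tau> s] relP[OF s(1)]
      by (metis subsetD)
    then show "x \<in> rel_of P s" using z by simp
  qed (use s in \<open>auto simp: Q_def\<close>)
  ultimately have "isomorphism \<tau> f P Q"
    using P inj by (auto simp: isomorphism_def bij_betw_def Q_def)
  then show thesis by (rule that)
qed

section \<open>Smallness\<close>

lemma inaccessible_infinite:
  assumes "inaccessible_type TYPE('u)"
  shows "Cinfinite |UNIV :: 'u set|"
  using assms infinite_iff_card_of_nat[of "UNIV :: 'u set"]
  unfolding inaccessible_type_def cinfinite_def Field_card_of
  using card_of_card_order_on ordLess_imp_ordLeq by blast

text \<open>An infinite regular cardinal is stable, and stability bounds small sums over arbitrary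
  types.\<close>

lemma small_Sigma:
  fixes B :: "'a \<Rightarrow> 'b set"
  assumes "inaccessible_type TYPE('u)" "|A| <o |UNIV :: 'u set|"
    "\<And>a. a \<in> A \<Longrightarrow> |B a| <o |UNIV :: 'u set|"
  shows "|SIGMA a : A. B a| <o |UNIV :: 'u set|"
proof -
  have "stable |UNIV :: 'u set|"
    using assms(1) inaccessible_infinite[OF assms(1)]
    by (intro regularCard_stable) (auto simp: inaccessible_type_def cinfinite_def)
  then show ?thesis using assms by (blast intro: stable_elim)
qed

text \<open>Inaccessibility speaks only of sets in \<open>'u\<close>, so \<open>A\<close> is first
  replaced by an equinumerous set there.\<close>

lemma small_Pow:
  fixes A :: "'a set"
  assumes "inaccessible_type TYPE('u)" "|A| <o |UNIV :: 'u set|"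
  shows "|Pow A| <o |UNIV :: 'u set|"
proof -
  have "|A| \<le>o |UNIV :: 'u set|" using assms(2) by (rule ordLess_imp_ordLeq)
  then obtain B :: "'u set" where B: "|A| =o |B|"
    using internalize_card_of_ordLeq2[of A "UNIV :: 'u set"] by auto
  have "|B| <o |UNIV :: 'u set|"
    using ordIso_ordLess_trans[OF ordIso_symmetric[OF B] assms(2)] .
  then have small: "|Pow B| <o |UNIV :: 'u set|"
    using assms(1) by (auto simp: inaccessible_type_def)
  obtain f where "bij_betw f A B" using B card_of_ordIso by blast
  then have "|Pow A| =o |Pow B|" by (rule card_of_ordIsoI[OF bij_betw_Pow])
  then show ?thesis using small by (rule ordIso_ordLess_trans)
qed

text \<open>Extensional functions are recovered from their graphs, which are members of the small
  set \<open>Pow (A \<times> B)\<close>.\<close>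

lemma small_PiE:
  assumes "inaccessible_type TYPE('u)" "|A| <o |UNIV :: 'u set|" "|B| <o |UNIV :: 'u set|"
  shows "|A \<rightarrow>\<^sub>E B| <o |UNIV :: 'u set|"
proof -
  let ?graph = "\<lambda>f. (\<lambda>a. (a, f a)) ` A"
  have "inj_on ?graph (A \<rightarrow>\<^sub>E B)"
  proof (rule inj_onI)
    fix f g assume fg: "f \<in> A \<rightarrow>\<^sub>E B" "g \<in> A \<rightarrow>\<^sub>E B" "?graph f = ?graph g"
    show "f = g"
    proof (rule PiE_ext[OF fg(1,2)])
      fix a assume "a \<in> A"
      then have "(a, f a) \<in> ?graph g" using fg(3) by blast
      then show "f a = g a" by auto
    qed
  qed
  moreover have "?graph ` (A \<rightarrow>\<^sub>E B) \<subseteq> Pow (A \<times> B)" by (auto simp: PiE_iff)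
  ultimately have "|A \<rightarrow>\<^sub>E B| \<le>o |Pow (A \<times> B)|" using card_of_ordLeq by blast
  also have "|Pow (A \<times> B)| <o |UNIV :: 'u set|"
    by (intro small_Pow small_Sigma assms)
  finally show ?thesis .
qed


section \<open>Embeddings\<close>

locale mu_aec =
  fixes \<mu> :: "'u rel" and K :: "'u aclass"
  assumes inaccessible: "inaccessible_type TYPE('u)"
    and regular_mu: "regular_cardinal \<mu>"
    and mu_AEC: "mu_AEC \<mu> K"
begin

abbreviation "\<tau> \<equiv> voc K"
abbreviation "emb \<equiv> K_embedding K"

section \<open>The axioms of an abstract class in usable form\<close>

lemma abstract_class: "abstract_class \<mu> K"
  using mu_AEC by (simp add: mu_AEC_def)

lemma disjoint_syms: "fun_syms \<tau> \<inter> rel_syms \<tau> = {}"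
  and arity_less: "s \<in> syms \<tau> \<Longrightarrow> |arity \<tau> s| <o \<mu>"
proof -
  have "wf_vocabulary \<mu> \<tau>"
    using abstract_class unfolding abstract_class_def by (elim conjE)
  then show "fun_syms \<tau> \<inter> rel_syms \<tau> = {}" "s \<in> syms \<tau> \<Longrightarrow> |arity \<tau> s| <o \<mu>"
    by (simp_all add: wf_vocabulary_def)
qed

lemma
  assumes "M \<in> models K"
  shows is_structure_model: "is_structure \<tau> M" and le_refl: "le K M M"
proof -
  have "\<forall>M\<in>models K. is_structure \<tau> M"
    using abstract_class unfolding abstract_class_def by (elim conjE)
  with assms show "is_structure \<tau> M" by blast
  have "\<forall>M\<in>models K. le K M M"
    using abstract_class unfolding abstract_class_def by (elim conjE)
  with assms show "le K M M" by blast
qed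

lemma
  assumes "le K M N"
  shows le_models1: "M \<in> models K" and le_models2: "N \<in> models K"
    and le_substructure: "substructure \<tau> M N"
proof -
  have "\<forall>M N. le K M N \<longrightarrow> M \<in> models K \<and> N \<in> models K \<and> substructure \<tau> M N"
    using abstract_class unfolding abstract_class_def by (elim conjE)
  with assms show "M \<in> models K" "N \<in> models K" "substructure \<tau> M N" by blast+
qed

lemma le_trans:
  assumes "le K M N" "le K N P"
  shows "le K M P"
proof -
  have "\<forall>M N P. le K M N \<and> le K N P \<longrightarrow> le K M P"
    using abstract_class unfolding abstract_class_def by (elim conjE)
  with assms show ?thesis by blast
qed

lemma isomorphism_le:
  assumes "le K M N" "isomorphism \<tau> f N N'" "isomorphism \<tau> f M M'"
  shows "le K M' N'"
proof -
  have "\<forall>f M N M' N'. le K M N \<and> isomorphism \<tau> f N N' \<and> isomorphism \<tau> f M M' \<longrightarrow> le K M' N'"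
    using abstract_class unfolding abstract_class_def by (elim conjE)
  with assms show ?thesis by blast
qed

lemma isomorphism_models:
  assumes "M \<in> models K" "isomorphism \<tau> f M N"
  shows "N \<in> models K"
proof -
  have "\<forall>f M M'. M \<in> models K \<and> isomorphism \<tau> f M M' \<longrightarrow> M' \<in> models K"
    using abstract_class unfolding abstract_class_def by (elim conjE)
  with assms show ?thesis by blast
qed

lemma le_univ: "le K M N \<Longrightarrow> univ M \<subseteq> univ N"
  using le_substructure[of M N] by (simp add: substructure_def)

lemma small_univ: "M \<in> models K \<Longrightarrow> small (univ M)"
  using is_structure_model[of M] by (simp add: is_structure_def)

text \<open>Coherence reduces comparison inside a common model to inclusion of universes, so later
  arguments can work with universes alone.\<close>

lemma le_of_subset:
  assumes "le K M N" "le K M' N" "univ M \<subseteq> univ M'"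
  shows "le K M M'"
proof -
  have "coherence K" using mu_AEC by (simp add: mu_AEC_def)
  moreover have "substructure \<tau> M M'"
    using assms le_substructure substructure_of_subset by blast
  ultimately show ?thesis
    using assms le_models1 le_models2 unfolding coherence_def by blast
qed

text \<open>Copying \<open>P\<close> along the same \<open>f\<close> makes both isomorphisms
  restrictions of one map, as the invariance of \<open>le\<close> requires.\<close>

lemma le_isomorphism_image:
  assumes "le K P M" "isomorphism \<tau> f M M'"
  obtains P' where "isomorphism \<tau> f P P'" "le K P' M'"
proof -
  have "inj_on f (univ P)"
    using isomorphism_inj[OF assms(2)] le_univ[OF assms(1)] by (rule inj_on_subset)
  then obtain P' where P': "isomorphism \<tau> f P P'"
    using isomorphic_copy[OF is_structure_model[OF le_models1[OF assms(1)]] _ disjoint_syms] by blast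
  show thesis using P' isomorphism_le[OF assms P'] by (rule that)
qed

section \<open>Calculus of embeddings\<close>

lemma embI:
  assumes "f \<in> extensional (univ M)" "isomorphism \<tau> f M M'" "le K M' N"
  shows "emb f M N"
  \<comment> \<open>\<open>M\<close> is a model because the inverse isomorphism carries the model
    \<open>M'\<close> onto it.\<close>
  using assms isomorphism_models[OF le_models1 isomorphism_inv] le_models2
  unfolding K_embedding_def by blast

lemma embE:
  assumes "emb f M N"
  obtains M' where "isomorphism \<tau> f M M'" "le K M' N" "univ M' = f ` univ M"
  using assms isomorphism_univ unfolding K_embedding_def by metis

lemma emb_models: "emb f M N \<Longrightarrow> M \<in> models K" "emb f M N \<Longrightarrow> N \<in> models K"
  by (auto simp: K_embedding_def)

lemma emb_inj: "emb f M N \<Longrightarrow> inj_on f (univ M)"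
  by (metis embE isomorphism_inj)

lemma emb_PiE:
  assumes "emb f M N"
  shows "f \<in> univ M \<rightarrow>\<^sub>E univ N"
proof -
  obtain M' where "le K M' N" "univ M' = f ` univ M" using assms by (rule embE)
  then have "f ` univ M \<subseteq> univ N" using le_univ by metis
  then show ?thesis using assms by (simp add: PiE_def K_embedding_def image_subset_iff Pi_iff)
qed

lemma emb_mem: "emb f M N \<Longrightarrow> a \<in> univ M \<Longrightarrow> f a \<in> univ N"
  using emb_PiE by blast

lemma emb_inclusion: "le K M N \<Longrightarrow> emb (restrict id (univ M)) M N"
  by (rule embI[OF _ isomorphism_cong[OF isomorphism_id]]) (auto intro: is_structure_model le_models1)

lemma emb_codomain:
  assumes "emb f M N" "le K P N" "f ` univ M \<subseteq> univ P"
  shows "emb f M P"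
proof -
  obtain M' where M': "isomorphism \<tau> f M M'" "le K M' N" "univ M' = f ` univ M"
    using assms(1) by (rule embE)
  then have "le K M' P" using le_of_subset[OF M'(2) assms(2)] assms(3) by simp
  then show ?thesis using M'(1) assms(1) by (intro embI) (auto simp: K_embedding_def)
qed

lemma emb_comp:
  assumes "emb f M N" "emb g N P"
  shows "emb (compose (univ M) g f) M P"
proof -
  obtain M' where M': "isomorphism \<tau> f M M'" "le K M' N" using assms(1) by (rule embE)
  obtain N' where N': "isomorphism \<tau> g N N'" "le K N' P" using assms(2) by (rule embE)
  obtain M'' where M'': "isomorphism \<tau> g M' M''" "le K M'' N'"
    using M'(2) N'(1) by (rule le_isomorphism_image)
  have "isomorphism \<tau> (compose (univ M) g f) M M''"
    by (rule isomorphism_cong[OF isomorphism_comp[OF M'(1) M''(1)]]) (auto simp: compose_def)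
  then show ?thesis using le_trans[OF M''(2) N'(2)] by (intro embI) auto
qed

lemma emb_le:
  assumes "emb f M N" "le K N P"
  shows "emb f M P"
proof -
  obtain M' where M': "isomorphism \<tau> f M M'" "le K M' N" using assms(1) by (rule embE)
  show ?thesis
    using assms(1) M'(1) le_trans[OF M'(2) assms(2)]
    by (intro embI) (auto simp: K_embedding_def)
qed

text \<open>Both images are models below \<open>X\<close>, so coherence compares them; the inverse
  of \<open>c\<close> then carries the image of \<open>f\<close> to a submodel of
  \<open>D\<close>.\<close>

lemma emb_factor:
  assumes f: "emb f M X" and c: "emb c D X" and sub: "f ` univ M \<subseteq> c ` univ D"
  obtains g where "emb g M D" "compose (univ M) c g = f"
proof -
  obtain M' where M': "isomorphism \<tau> f M M'" "le K M' X" "univ M' = f ` univ M"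
    using f by (rule embE)
  obtain D' where D': "isomorphism \<tau> c D D'" "le K D' X" "univ D' = c ` univ D"
    using c by (rule embE)
  have "le K M' D'" using le_of_subset[OF M'(2) D'(2)] M'(3) D'(3) sub by simp
  then obtain M'' where M'': "isomorphism \<tau> (inv_into (univ D) c) M' M''" "le K M'' D"
    using isomorphism_inv[OF D'(1)] by (rule le_isomorphism_image)
  define g where "g = compose (univ M) (inv_into (univ D) c) f"
  have "isomorphism \<tau> g M M''"
    by (rule isomorphism_cong[OF isomorphism_comp[OF M'(1) M''(1)]]) (auto simp: compose_def g_def)
  then have "emb g M D" using M''(2) by (intro embI) (auto simp: g_def)
  moreover have "compose (univ M) c g = f"
  proof (rule extensionalityI[of _ "univ M"])
    fix a assume "a \<in> univ M"
    then show "compose (univ M) c g a = f a"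
      using sub by (simp add: compose_def g_def f_inv_into_f image_subset_iff)
  qed (use f in \<open>auto simp: K_embedding_def\<close>)
  ultimately show thesis by (rule that)
qed

text \<open>Needed for hom-sets to be objects of \<open>set_cat\<close>.\<close>

lemma small_hom:
  assumes "M \<in> models K" "N \<in> models K"
  shows "|{f. emb f M N}| <o |UNIV :: 'u set|"
proof -
  have "|{f. emb f M N}| \<le>o |univ M \<rightarrow>\<^sub>E univ N|" by (rule card_of_mono1) (use emb_PiE in blast)
  also have "|univ M \<rightarrow>\<^sub>E univ N| <o |UNIV :: 'u set|"
    using assms[THEN small_univ] small_PiE[OF inaccessible] by (simp add: small_def)
  finally show ?thesis .
qed

text \<open>Embeddings are injective, hence monic. This takes care of the uniqueness of
  factorizations in presentability.\<close>

lemma emb_cancel: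
  assumes c: "emb c D X" and "emb g M D" "emb g' M D"
    and eq: "compose (univ M) c g = compose (univ M) c g'"
  shows "g = g'"
proof (rule PiE_ext[OF emb_PiE[OF assms(2)] emb_PiE[OF assms(3)]])
  fix a assume a: "a \<in> univ M"
  then have "c (g a) = c (g' a)" using fun_cong[OF eq, of a] by (simp add: compose_def)
  then show "g a = g' a"
    using emb_inj[OF c] a assms(2,3) by (auto dest: emb_mem inj_onD)
qed

end

section \<open>Directed colimits and presentability\<close>

lemma directed_poset_field: "directed_poset \<kappa> I r \<Longrightarrow> (i, j) \<in> r \<Longrightarrow> i \<in> I \<and> j \<in> I"
  and directed_poset_bound:
    "directed_poset \<kappa> I r \<Longrightarrow> X \<subseteq> I \<Longrightarrow> |X| <o \<kappa> \<Longrightarrow> \<exists>u\<in>I. \<forall>x\<in>X. (x, u) \<in> r"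
  by (auto simp: directed_poset_def partial_order_on_def preorder_on_def refl_on_def)

lemma directed_poset_mono:
  assumes "directed_poset \<kappa> I r" "\<mu> \<le>o \<kappa>"
  shows "directed_poset \<mu> I r"
proof -
  have "|X| <o \<mu> \<Longrightarrow> |X| <o \<kappa>" for X :: "'b set"
    using ordLess_ordLeq_trans assms(2) by blast
  then show ?thesis using assms(1) unfolding directed_poset_def by blast
qed

lemma regular_cardinalD:
  assumes "regular_cardinal \<kappa>"
  shows "Card_order \<kappa>" "Cinfinite \<kappa>" "regularCard \<kappa>" "small (Field \<kappa>)" "infinite (Field \<kappa>)"
  using assms by (auto simp: regular_cardinal_def cardinal_def cinfinite_def)

lemma finite_ordLess_regular: "regular_cardinal \<kappa> \<Longrightarrow> finite A \<Longrightarrow> |A| <o \<kappa>"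
  using regular_cardinalD[of \<kappa>]
  by (intro finite_ordLess_infinite)
    (auto simp: card_of_well_order_on Field_card_of intro: card_order_on_well_order_on)

text \<open>Choose an index for each element of \<open>A\<close>; fewer than \<open>\<kappa>\<close>
  indices have a common upper bound, and \<open>P\<close> persists upwards.\<close>

lemma directed_poset_bound_family:
  assumes dir: "directed_poset \<kappa> I r" and A: "|A| <o \<kappa>"
    and ex: "\<And>a. a \<in> A \<Longrightarrow> \<exists>i\<in>I. P i a"
    and mono: "\<And>i j a. (i, j) \<in> r \<Longrightarrow> P i a \<Longrightarrow> P j a"
  shows "\<exists>i\<in>I. \<forall>a\<in>A. P i a"
proof -
  obtain f where f: "\<And>a. a \<in> A \<Longrightarrow> f a \<in> I \<and> P (f a) a" using ex by metis
  have "|f ` A| <o \<kappa>" using ordLeq_ordLess_trans[OF card_of_image A] .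
  then obtain u where "u \<in> I" "\<forall>x\<in>f ` A. (x, u) \<in> r"
    using directed_poset_bound[OF dir, of "f ` A"] f by blast
  then show ?thesis using f mono by blast
qed

lemma cat_of_simps [simp]:
  "Ob (cat_of K) = models K" "Car (cat_of K) = univ" "Mor (cat_of K) M N = {f. K_embedding K f M N}"
  by (simp_all add: cat_of_def)

lemma set_cat_simps [simp]:
  "Ob (set_cat TYPE('u)) = {A. |A| <o |UNIV :: 'u set| }"
  "Car (set_cat TYPE('u)) = (\<lambda>A. A)"
  "Mor (set_cat TYPE('u)) = (\<lambda>A B. A \<rightarrow>\<^sub>E B)"
  by (simp_all add: set_cat_def)

text \<open>Every \<open>\<kappa>'\<close>-directed poset is \<open>\<kappa>\<close>-directed, so
  the larger cardinal tests no new diagrams.\<close>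

lemma presentable_mono:
  assumes "presentable \<kappa> C M" "\<kappa> \<le>o \<kappa>'"
  shows "presentable \<kappa>' C M"
  using assms(1) directed_poset_mono[OF _ assms(2)] unfolding presentable_def by blast

section \<open>Directed unions and colimits of models\<close>

context mu_aec
begin

text \<open>Coherence turns increasing universes below \<open>N\<close> into a directed system, and
  the chain axioms put its union below \<open>N\<close>.\<close>

lemma union_le:
  fixes I :: "'u set"
  assumes "small I" "directed_poset \<mu> I r"
    and le: "\<And>i. i \<in> I \<Longrightarrow> le K (M i) N"
    and mono: "\<And>i j. (i, j) \<in> r \<Longrightarrow> univ (M i) \<subseteq> univ (M j)"
    and N: "N \<in> models K"
  obtains U where "le K U N" "univ U = (\<Union>i\<in>I. univ (M i))" "\<forall>i\<in>I. le K (M i) U"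
proof -
  let ?U = "union_struct \<tau> I M"
  have "le K (M i) (M j)" if "(i, j) \<in> r" for i j
    using that directed_poset_field[OF assms(2) that] le mono by (blast intro: le_of_subset)
  then have "directed_system \<mu> K I r M"
    using assms(1,2) le le_models1 unfolding directed_system_def by blast
  moreover have "chain_axioms \<mu> K" using mu_AEC by (simp add: mu_AEC_def)
  ultimately have "\<forall>i\<in>I. le K (M i) ?U" "\<forall>N\<in>models K. (\<forall>i\<in>I. le K (M i) N) \<longrightarrow> le K ?U N"
    unfolding chain_axioms_def by blast+
  then show thesis using that[of ?U] le N by (simp add: union_struct_def)
qed

lemma diagram_emb:
  assumes "diagram (cat_of K) I r D d" "(i, j) \<in> r"
  shows "emb (d i j) (D i) (D j)"
proof -
  have "\<forall>(i, j)\<in>r. d i j \<in> Mor (cat_of K) (D i) (D j)"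
    using assms(1) unfolding diagram_def by (elim conjE)
  then show ?thesis using assms(2) by auto
qed

lemma
  assumes "cocone (cat_of K) I r D d X c"
  shows cocone_models: "X \<in> models K"
    and cocone_emb: "\<And>i. i \<in> I \<Longrightarrow> emb (c i) (D i) X"
    and cocone_commute: "\<And>i j. (i, j) \<in> r \<Longrightarrow> compose (univ (D i)) (c j) (d i j) = c i"
  using assms by (auto simp: cocone_def)

lemma cocone_image_mono:
  assumes "diagram (cat_of K) I r D d" "cocone (cat_of K) I r D d X c" "(i, j) \<in> r"
  shows "c i ` univ (D i) \<subseteq> c j ` univ (D j)"
proof -
  have "c i a = c j (d i j a)" "d i j a \<in> univ (D j)" if "a \<in> univ (D i)" for a
    using fun_cong[OF cocone_commute[OF assms(2,3)], of a] that
      emb_mem[OF diagram_emb[OF assms(1,3)] that]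
    by (simp_all add: compose_def)
  then show ?thesis by auto
qed

text \<open>The cocone factors through the union of the images, so by uniqueness of the
  comparison map that union is everything.\<close>

lemma colimit_univ:
  fixes I :: "'u set"
  assumes I: "small I" and dir: "directed_poset \<mu> I r"
    and diag: "diagram (cat_of K) I r D d" and col: "colimit (cat_of K) I r D d X c"
  shows "univ X = (\<Union>i\<in>I. c i ` univ (D i))"
proof -
  have cocone: "cocone (cat_of K) I r D d X c" using col by (simp add: colimit_def)
  note X = cocone_models[OF cocone] and c = cocone_emb[OF cocone] and comm = cocone_commute[OF cocone]
  have universal: "\<exists>!h. emb h X Y \<and> (\<forall>i\<in>I. compose (univ (D i)) h (c i) = e i)"
    if "cocone (cat_of K) I r D d Y e" for Y e
    using col that by (simp add: colimit_def)
  have "\<exists>M'. le K M' X \<and> univ M' = c i ` univ (D i)" if "i \<in> I" for i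
    by (rule embE[OF c[OF that]]) auto
  then obtain E where E: "\<And>i. i \<in> I \<Longrightarrow> le K (E i) X" "\<And>i. i \<in> I \<Longrightarrow> univ (E i) = c i ` univ (D i)"
    by metis
  have sub: "univ (E i) \<subseteq> univ (E j)" if "(i, j) \<in> r" for i j
    using cocone_image_mono[OF diag cocone that] E(2) directed_poset_field[OF dir that] by simp
  obtain U where U: "le K U X" "univ U = (\<Union>i\<in>I. univ (E i))" "\<forall>i\<in>I. le K (E i) U"
    by (rule union_le[OF I dir E(1) sub X])
  have "emb (c i) (D i) U" if "i \<in> I" for i
    using emb_codomain[OF c[OF that] U(1)] E(2) U(2) that by auto
  then have "cocone (cat_of K) I r D d U c"
    using cocone le_models1[OF U(1)] by (auto simp: cocone_def)
  then obtain h where h: "emb h X U" "\<And>i. i \<in> I \<Longrightarrow> compose (univ (D i)) h (c i) = c i"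
    using universal by blast
  have "compose (univ (D i)) (restrict id (univ X)) (c i) = c i" if "i \<in> I" for i
    by (rule extensionalityI[of _ "univ (D i)"])
      (use c[OF that] emb_mem[OF c[OF that]] in \<open>auto simp: compose_def K_embedding_def\<close>)
  \<comment> \<open>\<open>h\<close>, viewed as a map into \<open>X\<close>, and the identity both
    commute with the cocone, so universality identifies them.\<close>
  then have "h = restrict id (univ X)"
    using universal[OF cocone] h(2) emb_le[OF h(1) U(1)] emb_inclusion[OF le_refl[OF X]] by blast
  then have "univ X \<subseteq> univ U" using emb_mem[OF h(1)] by auto
  then show ?thesis using U E le_univ[OF U(1)] by auto
qed

text \<open>The legs of a cocone agree on overlaps by directedness, so they glue to one map. It
  preserves structure because each tuple, of length below \<open>\<mu>\<close>, already lies in one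
  stage.\<close>

lemma union_colimit:
  fixes I :: "'u set"
  assumes dir: "directed_poset \<mu> I r" and I: "small I"
    and le: "\<And>i. i \<in> I \<Longrightarrow> le K (D i) M" and mono: "\<And>i j. (i, j) \<in> r \<Longrightarrow> univ (D i) \<subseteq> univ (D j)"
    and M: "M \<in> models K" "univ M = (\<Union>i\<in>I. univ (D i))"
  defines "d \<equiv> \<lambda>i j. restrict id (univ (D i))" and "c \<equiv> \<lambda>i. restrict id (univ (D i))"
  shows "diagram (cat_of K) I r D d" "colimit (cat_of K) I r D d M c"
proof -
  note IJ = directed_poset_field[OF dir]
  have d: "emb (d i j) (D i) (D j)" if "(i, j) \<in> r" for i j
    unfolding d_def using that IJ[OF that] le mono by (blast intro: emb_inclusion le_of_subset)
  show "diagram (cat_of K) I r D d"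
    unfolding diagram_def
  proof (intro conjI ballI allI impI, goal_cases)
    case (4 i j k)
    then show ?case
      using mono[of i j] by (auto simp: d_def compose_def restrict_def intro!: ext)
  qed (use d le_models1[OF le] in \<open>auto simp: d_def\<close>)
  have c: "cocone (cat_of K) I r D d M c"
    unfolding cocone_def
  proof (intro conjI ballI, goal_cases)
    case (3 p)
    then show ?case
      using mono[of "fst p" "snd p"] by (auto simp: d_def c_def compose_def restrict_def split: prod.split intro!: ext)
  qed (use M emb_inclusion[OF le] in \<open>auto simp: c_def\<close>)
  have "\<exists>!h. emb h M Y \<and> (\<forall>i\<in>I. compose (univ (D i)) h (c i) = e i)"
    if e: "cocone (cat_of K) I r D d Y e" for Y e
  proof -
    note Y = cocone_models[OF e] and e_emb = cocone_emb[OF e] and comm = cocone_commute[OF e]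
    have agree: "e j a = e i a" if "(i, j) \<in> r" "a \<in> univ (D i)" for i j a
      using fun_cong[OF comm[OF that(1)], of a] that(2) by (simp add: compose_def d_def)
    have common: "\<exists>k\<in>I. (i, k) \<in> r \<and> (j, k) \<in> r" if "i \<in> I" "j \<in> I" for i j
      using directed_poset_bound[OF dir, of "{i, j}"] that
        finite_ordLess_regular[OF regular_mu, of "{i, j}"] by auto
    \<comment> \<open>An arbitrary stage containing \<open>a\<close> is chosen; moving to a common
      upper bound shows that the value does not depend on it.\<close>
    define h where "h = (\<lambda>a\<in>univ M. e (SOME i. i \<in> I \<and> a \<in> univ (D i)) a)"
    have h: "h a = e i a" if i: "i \<in> I" "a \<in> univ (D i)" for i a
    proof -
      let ?j = "SOME i. i \<in> I \<and> a \<in> univ (D i)"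
      have j: "?j \<in> I \<and> a \<in> univ (D ?j)" by (rule someI[of _ i]) (use i in auto)
      obtain k where "k \<in> I" "(i, k) \<in> r" "(?j, k) \<in> r" using common i j by blast
      then have "e ?j a = e i a" using agree i j by metis
      then show ?thesis using i M(2) by (auto simp: h_def)
    qed
    \<comment> \<open>The images of the legs form a directed system below \<open>Y\<close>, whose
      union \<open>U\<close> will be the image of \<open>h\<close>.\<close>
    have "\<exists>M'. isomorphism \<tau> (e i) (D i) M' \<and> le K M' Y \<and> univ M' = e i ` univ (D i)" if "i \<in> I" for i
      by (rule embE[OF e_emb[OF that]]) auto
    then obtain E where E: "\<And>i. i \<in> I \<Longrightarrow> isomorphism \<tau> (e i) (D i) (E i)"
      "\<And>i. i \<in> I \<Longrightarrow> le K (E i) Y" "\<And>i. i \<in> I \<Longrightarrow> univ (E i) = e i ` univ (D i)"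
      by metis
    have Esub: "univ (E i) \<subseteq> univ (E j)" if "(i, j) \<in> r" for i j
      using IJ[OF that] image_mono[OF mono[OF that], of "e j"] agree[OF that]
      by (simp add: E(3) cong: image_cong_simp)
    obtain U where U: "le K U Y" "univ U = (\<Union>i\<in>I. univ (E i))" "\<forall>i\<in>I. le K (E i) U"
      by (rule union_le[OF I dir E(2) Esub Y])
    \<comment> \<open>Arities are below \<open>\<mu>\<close>, so the stages holding the entries of a
      tuple have a common bound.\<close>
    have tuple: "\<exists>i\<in>I. x \<in> tuples \<tau> s (univ (D i))" if "s \<in> syms \<tau>" "x \<in> tuples \<tau> s (univ M)" for s x
    proof -
      have "\<exists>i\<in>I. \<forall>a\<in>arity \<tau> s. x a \<in> univ (D i)"
      proof (rule directed_poset_bound_family[OF dir arity_less[OF that(1)]])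
        show "\<exists>i\<in>I. x a \<in> univ (D i)" if "a \<in> arity \<tau> s" for a
          using PiE_mem[OF \<open>x \<in> tuples \<tau> s (univ M)\<close> that] M(2) by simp
        show "x a \<in> univ (D j)" if "(i, j) \<in> r" "x a \<in> univ (D i)" for i j a
          using mono that by blast
      qed
      then show ?thesis using that(2) by (auto simp: PiE_iff)
    qed
    have sub: "substructure \<tau> (D i) M" "substructure \<tau> (E i) U" if "i \<in> I" for i
      using that le U(3) le_substructure by blast+
    have "isomorphism \<tau> h M U"
      unfolding isomorphism_def
    proof (intro conjI ballI)
      show "is_structure \<tau> M" "is_structure \<tau> U"
        using is_structure_model M(1) le_models1[OF U(1)] by blast+
      show "bij_betw h (univ M) (univ U)"
        unfolding bij_betw_def
      proof
        show "inj_on h (univ M)"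
        proof (rule inj_onI)
          fix a b assume ab: "a \<in> univ M" "b \<in> univ M" "h a = h b"
          then obtain i j where "i \<in> I" "a \<in> univ (D i)" "j \<in> I" "b \<in> univ (D j)" using M(2) by auto
          moreover from this obtain k where "k \<in> I" "(i, k) \<in> r" "(j, k) \<in> r" using common by blast
          ultimately have k: "k \<in> I" "a \<in> univ (D k)" "b \<in> univ (D k)" using mono by blast+
          then show "a = b" using h ab(3) emb_inj[OF e_emb[OF k(1)]] by (auto dest: inj_onD)
        qed
        show "h ` univ M = univ U"
          by (simp add: M(2) U(2) image_UN h E(3) cong: image_cong_simp SUP_cong_simp)
      qed
    next
      fix s x assume s: "s \<in> fun_syms \<tau>" and x: "x \<in> tuples \<tau> s (univ M)"
      then obtain i where i: "i \<in> I" "x \<in> tuples \<tau> s (univ (D i))"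
        using tuple[OF _ x] by (auto simp: syms_def simp del: PiE_iff)
      have hx: "compose (arity \<tau> s) h x = compose (arity \<tau> s) (e i) x"
        using i(2) h[OF i(1)] by (rule compose_cong_on_tuples)
      have y: "compose (arity \<tau> s) (e i) x \<in> tuples \<tau> s (univ (E i))"
        using i E(3) by (intro compose_in_tuples) auto
      have "h (fun_of M s x) = h (fun_of (D i) s x)"
        using sub(1)[OF i(1)] s i(2) by (simp add: substructure_def)
      also have "\<dots> = e i (fun_of (D i) s x)"
        using h[OF i(1)] fun_of_closed[OF _ s i(2)] sub(1)[OF i(1)] by (simp add: substructure_def)
      also have "\<dots> = fun_of (E i) s (compose (arity \<tau> s) (e i) x)"
        using E(1)[OF i(1)] s i(2) by (simp add: isomorphism_def)
      also have "\<dots> = fun_of U s (compose (arity \<tau> s) h x)"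
        using sub(2)[OF i(1)] s y by (simp add: substructure_def hx)
      finally show "h (fun_of M s x) = fun_of U s (compose (arity \<tau> s) h x)" .
    next
      fix s x assume s: "s \<in> rel_syms \<tau>" and x: "x \<in> tuples \<tau> s (univ M)"
      then obtain i where i: "i \<in> I" "x \<in> tuples \<tau> s (univ (D i))"
        using tuple[OF _ x] by (auto simp: syms_def simp del: PiE_iff)
      have hx: "compose (arity \<tau> s) h x = compose (arity \<tau> s) (e i) x"
        using i(2) h[OF i(1)] by (rule compose_cong_on_tuples)
      have y: "compose (arity \<tau> s) (e i) x \<in> tuples \<tau> s (univ (E i))"
        using i E(3) by (intro compose_in_tuples) auto
      have "x \<in> rel_of M s \<longleftrightarrow> x \<in> rel_of (D i) s"
        using sub(1)[OF i(1)] s i(2) by (auto simp: substructure_def)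
      also have "\<dots> \<longleftrightarrow> compose (arity \<tau> s) (e i) x \<in> rel_of (E i) s"
        using E(1)[OF i(1)] s i(2) by (simp add: isomorphism_def)
      also have "\<dots> \<longleftrightarrow> compose (arity \<tau> s) h x \<in> rel_of U s"
        using sub(2)[OF i(1)] s y by (simp add: substructure_def hx)
      finally show "x \<in> rel_of M s \<longleftrightarrow> compose (arity \<tau> s) h x \<in> rel_of U s" .
    qed
    then have "emb h M Y" using U(1) by (intro embI) (auto simp: h_def)
    moreover have "compose (univ (D i)) h (c i) = e i" if "i \<in> I" for i
      by (rule extensionalityI[of _ "univ (D i)"])
        (use h[OF that] e_emb[OF that] in \<open>auto simp: compose_def c_def K_embedding_def\<close>)
    moreover have "h' = h" if h': "emb h' M Y" "\<forall>i\<in>I. compose (univ (D i)) h' (c i) = e i" for h'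
    proof (rule PiE_ext[OF emb_PiE[OF h'(1)] emb_PiE[OF \<open>emb h M Y\<close>]])
      fix a assume "a \<in> univ M"
      then obtain i where i: "i \<in> I" "a \<in> univ (D i)" using M(2) by auto
      then have "compose (univ (D i)) h' (c i) a = e i a" using h'(2) by simp
      then show "h' a = h a" using i h by (simp add: compose_def c_def)
    qed
    ultimately show ?thesis by blast
  qed
  then show "colimit (cat_of K) I r D d M c" using c by (simp add: colimit_def)
qed


text \<open>Only existence of factorizations has to be assumed: two factorizations of one map merge
  at a common later stage because embeddings are monic.\<close>

lemma presentableI:
  assumes kappa: "regular_cardinal \<kappa>" and M: "M \<in> models K"
    and factor: "\<And>(I :: 'u set) r D d X c f. \<lbrakk>small I; directed_poset \<kappa> I r; diagram (cat_of K) I r D d;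
      colimit (cat_of K) I r D d X c; emb f M X\<rbrakk>
      \<Longrightarrow> \<exists>i\<in>I. \<exists>g. emb g M (D i) \<and> compose (univ M) (c i) g = f"
  shows "presentable \<kappa> (cat_of K) M"
  unfolding presentable_def
proof (intro conjI allI impI; (elim conjE)?)
  show "M \<in> Ob (cat_of K)" using M by simp
  fix I :: "'u set" and r D d X c
  assume I: "small I" and dir: "directed_poset \<kappa> I r" and diag: "diagram (cat_of K) I r D d"
    and col: "colimit (cat_of K) I r D d X c"
  have cocone: "cocone (cat_of K) I r D d X c" using col by (simp add: colimit_def)
  note X = cocone_models[OF cocone] and c = cocone_emb[OF cocone] and comm = cocone_commute[OF cocone]
  note d = diagram_emb[OF diag]
  let ?H = "\<lambda>N. {f. emb f M N}"
  let ?m = "\<lambda>N g. (\<lambda>f\<in>?H N. compose (univ M) g f)"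
  have comp: "compose (univ M) (c j) (compose (univ M) (d i j) g) = compose (univ M) (c i) g"
    if "(i, j) \<in> r" "emb g M (D i)" for i j g
    using compose_assoc[of g "univ M" "univ (D i)" "c j" "d i j"] emb_PiE[OF that(2)] comm[OF that(1)]
    by (simp add: PiE_def)
  have set_cocone: "cocone (set_cat TYPE('u)) I r (\<lambda>i. ?H (D i)) (\<lambda>i j. ?m (D i) (d i j)) (?H X) (\<lambda>i. ?m (D i) (c i))"
    unfolding cocone_def
  proof (intro conjI ballI, goal_cases)
    case 1
    then show ?case using small_hom[OF M X] by simp
  next
    case (2 i)
    then show ?case using emb_comp[OF _ c] by auto
  next
    case (3 p)
    obtain i j where p: "p = (i, j)" by (cases p)
    have "compose (?H (D i)) (?m (D j) (c j)) (?m (D i) (d i j)) = ?m (D i) (c i)"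
    proof
      fix g
      show "compose (?H (D i)) (?m (D j) (c j)) (?m (D i) (d i j)) g = ?m (D i) (c i) g"
        using emb_comp[of g M "D i" "d i j" "D j"] comp[of i j g] d[of i j] 3 p
        by (simp add: compose_def[of "?H (D i)"])
    qed
    then show ?case by (simp add: p)
  qed
  have "\<exists>!h. h \<in> ?H X \<rightarrow>\<^sub>E Y \<and> (\<forall>i\<in>I. compose (?H (D i)) h (?m (D i) (c i)) = e i)"
    if e: "cocone (set_cat TYPE('u)) I r (\<lambda>i. ?H (D i)) (\<lambda>i j. ?m (D i) (d i j)) Y e" for Y e
  proof -
    have e_mem: "e i \<in> ?H (D i) \<rightarrow>\<^sub>E Y" if "i \<in> I" for i
      using e that by (simp add: cocone_def)
    have e_comm: "e j (compose (univ M) (d i j) g) = e i g" if "(i, j) \<in> r" "emb g M (D i)" for i j g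
    proof -
      have "\<forall>(i, j)\<in>r. compose (?H (D i)) (e j) (?m (D i) (d i j)) = e i"
        using e by (simp add: cocone_def)
      then have "compose (?H (D i)) (e j) (?m (D i) (d i j)) g = e i g" using that(1) by fastforce
      then show ?thesis using that(2) by (simp add: compose_def[of "?H (D i)"])
    qed
    \<comment> \<open>Both maps are pushed to a common stage \<open>k\<close>, where the embedding
      \<open>c k\<close> is cancelled; the cocone \<open>e\<close> then identifies the
      values.\<close>
    have well_def: "e i g = e j g'"
      if i: "i \<in> I" "emb g M (D i)" and j: "j \<in> I" "emb g' M (D j)"
        and eq: "compose (univ M) (c i) g = compose (univ M) (c j) g'" for i j g g'
    proof -
      obtain k where k: "k \<in> I" "(i, k) \<in> r" "(j, k) \<in> r"
        using directed_poset_bound[OF dir, of "{i, j}"] i j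
          finite_ordLess_regular[OF kappa, of "{i, j}"] by auto
      have "compose (univ M) (d i k) g = compose (univ M) (d j k) g'"
        using eq comp[OF k(2) i(2)] comp[OF k(3) j(2)]
        by (intro emb_cancel[OF c[OF k(1)] emb_comp[OF i(2) d[OF k(2)]] emb_comp[OF j(2) d[OF k(3)]]]) simp
      then show ?thesis using e_comm[OF k(2) i(2)] e_comm[OF k(3) j(2)] by simp
    qed
    have "\<exists>i g. i \<in> I \<and> emb g M (D i) \<and> compose (univ M) (c i) g = f" if "emb f M X" for f
      using factor[OF I dir diag col that] by blast
    then obtain ix fac where fac: "\<And>f. emb f M X \<Longrightarrow> ix f \<in> I \<and> emb (fac f) M (D (ix f))
        \<and> compose (univ M) (c (ix f)) (fac f) = f"
      by metis
    \<comment> \<open>One factorization is chosen for each map into \<open>X\<close>; by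
      \<open>well_def\<close> the choice does not affect the value.\<close>
    define h where "h = (\<lambda>f\<in>?H X. e (ix f) (fac f))"
    have h: "h (compose (univ M) (c i) g) = e i g" if "i \<in> I" "emb g M (D i)" for i g
    proof -
      have f: "emb (compose (univ M) (c i) g) M X" using emb_comp[OF that(2) c[OF that(1)]] .
      let ?f = "compose (univ M) (c i) g"
      have "h ?f = e (ix ?f) (fac ?f)" using f by (simp add: h_def)
      also have "\<dots> = e i g" using fac[OF f] that by (intro well_def) simp_all
      finally show ?thesis .
    qed
    have 1: "h \<in> ?H X \<rightarrow>\<^sub>E Y"
    proof (intro PiE_I)
      show "h f \<in> Y" if "f \<in> ?H X" for f
        using that fac[of f] e_mem[of "ix f"] by (auto simp: h_def)
    qed (simp add: h_def)
    have 2: "compose (?H (D i)) h (?m (D i) (c i)) = e i" if i: "i \<in> I" for i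
      by (rule extensionalityI[of _ "?H (D i)"])
        (use h[OF i] e_mem[OF i] in \<open>auto simp: compose_def[of "?H (D i)"] PiE_iff\<close>)
    have 3: "h' = h" if h': "h' \<in> ?H X \<rightarrow>\<^sub>E Y" "\<forall>i\<in>I. compose (?H (D i)) h' (?m (D i) (c i)) = e i" for h'
    proof (rule PiE_ext[OF h'(1) 1])
      fix f assume "f \<in> ?H X"
      then have f: "ix f \<in> I" "emb (fac f) M (D (ix f))" "compose (univ M) (c (ix f)) (fac f) = f"
        using fac by auto
      have "compose (?H (D (ix f))) h' (?m (D (ix f)) (c (ix f))) (fac f) = e (ix f) (fac f)"
        using h'(2) f(1) by simp
      then show "h' f = h f" using h[OF f(1,2)] f by (simp add: compose_def[of "?H (D (ix f))"])
    qed
    show ?thesis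
      by (intro ex1I[of _ h] conjI ballI 1 2) (assumption, elim conjE, rule 3)
  qed
  then have "colimit (set_cat TYPE('u)) I r (\<lambda>i. ?H (D i)) (\<lambda>i j. ?m (D i) (d i j)) (?H X) (\<lambda>i. ?m (D i) (c i))"
    using set_cocone by (simp add: colimit_def)
  then show "colimit (set_cat TYPE('u)) I r (\<lambda>i. Mor (cat_of K) M (D i)) (\<lambda>i j. hom_map (cat_of K) M (D i) (d i j))
      (Mor (cat_of K) M X) (\<lambda>i. hom_map (cat_of K) M (D i) (c i))"
    by (simp add: hom_map_def)
qed

text \<open>A map outside all the images could be sent to either of two points, against uniqueness.\<close>

lemma presentable_factor:
  fixes I :: "'u set"
  assumes pres: "presentable \<kappa> (cat_of K) M"
    and I: "small I" "directed_poset \<kappa> I r" "diagram (cat_of K) I r D d" and col: "colimit (cat_of K) I r D d X c"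
    and f: "emb f M X"
  obtains i g where "i \<in> I" "emb g M (D i)" "compose (univ M) (c i) g = f"
proof -
  let ?H = "\<lambda>N. {f. emb f M N}"
  let ?m = "\<lambda>N g. (\<lambda>f\<in>?H N. compose (univ M) g f)"
  have "colimit (set_cat TYPE('u)) I r (\<lambda>i. Mor (cat_of K) M (D i)) (\<lambda>i j. hom_map (cat_of K) M (D i) (d i j))
      (Mor (cat_of K) M X) (\<lambda>i. hom_map (cat_of K) M (D i) (c i))"
    using pres I col unfolding presentable_def by blast
  then have set_col: "colimit (set_cat TYPE('u)) I r (\<lambda>i. ?H (D i)) (\<lambda>i j. ?m (D i) (d i j)) (?H X) (\<lambda>i. ?m (D i) (c i))"
    by (simp add: hom_map_def)
  have "infinite (UNIV :: 'u set)" using inaccessible_infinite[OF inaccessible] by (simp add: cinfinite_def Field_card_of)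
  then obtain a b :: 'u where ab: "a \<noteq> b" by (metis ex_new_if_finite finite.emptyI finite_insert insertI1)
  \<comment> \<open>The hom-functor lands in sets of functions on \<open>'u\<close>, so the two test
    points are taken to be constant functions.\<close>
  let ?a = "\<lambda>_ :: 'u. a" and ?b = "\<lambda>_ :: 'u. b"
  let ?Y = "{?a, ?b}"
  let ?e = "\<lambda>i. \<lambda>g\<in>?H (D i). ?a"
  have set_cocone: "cocone (set_cat TYPE('u)) I r (\<lambda>i. ?H (D i)) (\<lambda>i j. ?m (D i) (d i j)) (?H X) (\<lambda>i. ?m (D i) (c i))"
    using set_col by (simp add: colimit_def)
  have c: "emb (compose (univ M) (c i) g) M X" if "i \<in> I" "emb g M (D i)" for i g
  proof -
    have "?m (D i) (c i) \<in> ?H (D i) \<rightarrow>\<^sub>E ?H X" using set_cocone that(1) by (simp add: cocone_def)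
    then have "?m (D i) (c i) g \<in> ?H X" using that(2) by (blast dest: PiE_mem)
    then show ?thesis using that(2) by simp
  qed
  note d = diagram_emb[OF I(3)]
  have "|?Y| <o |UNIV :: 'u set|"
    using inaccessible_infinite[OF inaccessible]
    by (intro finite_ordLess_infinite)
      (auto simp: card_of_well_order_on Field_card_of card_of_Well_order cinfinite_def)
  moreover have "compose (?H (D i)) (?e j) (?m (D i) (d i j)) = ?e i" if "(i, j) \<in> r" for i j
    using emb_comp[OF _ d[OF that]] by (intro ext) (simp add: compose_def[of "?H (D i)"])
  ultimately have "cocone (set_cat TYPE('u)) I r (\<lambda>i. ?H (D i)) (\<lambda>i j. ?m (D i) (d i j)) ?Y ?e"
    by (auto simp: cocone_def)
  moreover define Q where
    "Q h \<longleftrightarrow> h \<in> ?H X \<rightarrow>\<^sub>E ?Y \<and> (\<forall>i\<in>I. compose (?H (D i)) h (?m (D i) (c i)) = ?e i)" for h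
  ultimately have uniq: "\<exists>!h. Q h"
    using set_col by (simp add: colimit_def)
  show thesis
  proof (rule ccontr)
    assume "\<not> thesis"
    then have no: "compose (univ M) (c i) g \<noteq> f" if "i \<in> I" "emb g M (D i)" for i g
      using that \<open>\<And>i g. i \<in> I \<Longrightarrow> emb g M (D i) \<Longrightarrow> compose (univ M) (c i) g = f \<Longrightarrow> thesis\<close> by blast
    \<comment> \<open>\<open>?h x\<close> can differ from the constant map only at \<open>f\<close>.
      As no stage reaches \<open>f\<close>, both choices of \<open>x\<close> commute with the
      cocone.\<close>
    let ?h = "\<lambda>x. \<lambda>g\<in>?H X. if g = f then x else ?a"
    have "Q (?h x)" if "x \<in> ?Y" for x
      unfolding Q_def
    proof (intro conjI ballI)
      show "?h x \<in> ?H X \<rightarrow>\<^sub>E ?Y" using that by auto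
      show "compose (?H (D i)) (?h x) (?m (D i) (c i)) = ?e i" if "i \<in> I" for i
        using c[OF that] no[OF that] by (intro ext) (simp add: compose_def[of "?H (D i)"])
    qed
    then have "Q (?h ?a)" "Q (?h ?b)" by blast+
    with uniq have "?h ?a = ?h ?b" by metis
    then have "?h ?a f = ?h ?b f" by (rule fun_cong)
    then show False using f ab by (simp add: fun_eq_iff)
  qed
qed

end

section \<open>Closures\<close>

locale mu_aec_intersections = mu_aec \<mu> K for \<mu> :: "'u rel" and K +
  assumes admits_intersections: "admits_intersections K"
begin

section \<open>Elementary properties of the closure operator\<close>

lemma cl_model:
  assumes "N \<in> models K" "A \<subseteq> univ N"
  obtains P where "le K P N" "univ P = cl K N A"
  using assms admits_intersections unfolding admits_intersections_def by blast

lemma subset_cl: "A \<subseteq> cl K N A"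
  by (auto simp: cl_def)

lemma cl_least: "le K M N \<Longrightarrow> A \<subseteq> univ M \<Longrightarrow> cl K N A \<subseteq> univ M"
  by (auto simp: cl_def)

lemma cl_mono: "A \<subseteq> B \<Longrightarrow> cl K N A \<subseteq> cl K N B"
  unfolding cl_def by (rule Inter_anti_mono) auto

lemma cl_subset_univ: "N \<in> models K \<Longrightarrow> A \<subseteq> univ N \<Longrightarrow> cl K N A \<subseteq> univ N"
  by (rule cl_least[OF le_refl])

text \<open>The closure in \<open>N\<close> lies inside \<open>M\<close>, hence is a submodel of
  \<open>M\<close> by coherence; submodels of \<open>M\<close> are submodels of \<open>N\<close>. So
  each closure occurs among the sets intersected for the other.\<close>

lemma cl_le:
  assumes "le K M N" "A \<subseteq> univ M"
  shows "cl K M A = cl K N A"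
proof
  obtain P where P: "le K P N" "univ P = cl K N A"
    using cl_model[OF le_models2[OF assms(1)]] le_univ[OF assms(1)] assms(2) by blast
  have "le K P M" using P cl_least[OF assms] by (intro le_of_subset[OF P(1) assms(1)]) simp
  then show "cl K M A \<subseteq> cl K N A" using cl_least[of P M A] P(2) subset_cl[of A N] by simp
  obtain Q where Q: "le K Q M" "univ Q = cl K M A"
    using cl_model[OF le_models1[OF assms(1)] assms(2)] .
  then show "cl K N A \<subseteq> cl K M A"
    using cl_least[OF le_trans[OF Q(1) assms(1)], of A] subset_cl[of A M] by simp
qed

text \<open>Fewer than \<open>\<kappa>\<close> generators have their images in one stage. The image
  of that stage is a submodel of \<open>X\<close>, so it contains the closure of those images, which
  is the whole image of \<open>M\<close>.\<close>

lemma generated_presentable: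
  assumes kappa: "regular_cardinal \<kappa>" "\<mu> \<le>o \<kappa>" and M: "M \<in> models K"
    and A: "A \<subseteq> univ M" "|A| <o \<kappa>" "cl K M A = univ M"
  shows "presentable \<kappa> (cat_of K) M"
proof (rule presentableI[OF kappa(1) M])
  fix I :: "'u set" and r D d X c f
  assume I: "small I" and dir: "directed_poset \<kappa> I r" and diag: "diagram (cat_of K) I r D d"
    and col: "colimit (cat_of K) I r D d X c" and f: "emb f M X"
  have cocone: "cocone (cat_of K) I r D d X c" using col by (simp add: colimit_def)
  have "\<exists>i\<in>I. \<forall>a\<in>A. f a \<in> c i ` univ (D i)"
  proof (rule directed_poset_bound_family[OF dir A(2)])
    show "\<exists>i\<in>I. f a \<in> c i ` univ (D i)" if "a \<in> A" for a
      using colimit_univ[OF I directed_poset_mono[OF dir kappa(2)] diag col] that A(1) emb_mem[OF f]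
      by auto
    show "f a \<in> c j ` univ (D j)" if "(i, j) \<in> r" "f a \<in> c i ` univ (D i)" for i j a
      using cocone_image_mono[OF diag cocone that(1)] that(2) by blast
  qed
  then obtain i where i: "i \<in> I" "f ` A \<subseteq> c i ` univ (D i)" by blast
  note c = cocone_emb[OF cocone i(1)]
  obtain E where E: "le K E X" "univ E = c i ` univ (D i)" using c by (rule embE)
  obtain M' where M': "isomorphism \<tau> f M M'" "le K M' X" "univ M' = f ` univ M"
    using f by (rule embE)
  have fA: "f ` A \<subseteq> univ M'" "f ` A \<subseteq> univ E" using A(1) M'(3) E(2) i(2) by auto
  \<comment> \<open>\<open>P\<close> lies inside the image \<open>M'\<close>. Its preimage is a
    submodel of \<open>M\<close> containing the generators, hence all of \<open>M\<close>, so
    \<open>P\<close> exhausts the image of \<open>f\<close>.\<close>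
  obtain P where P: "le K P X" "univ P = cl K X (f ` A)"
    using cl_model[OF emb_models(2)[OF f], of "f ` A"] fA(1) le_univ[OF M'(2)] by blast
  have PM: "le K P M'" using le_of_subset[OF P(1) M'(2)] P(2) cl_least[OF M'(2) fA(1)] by simp
  let ?g = "inv_into (univ M) f"
  obtain P' where P': "isomorphism \<tau> ?g P P'" "le K P' M"
    using PM isomorphism_inv[OF M'(1)] by (rule le_isomorphism_image)
  note g_f = inv_into_f_f[OF emb_inj[OF f]]
  have AP: "A \<subseteq> univ P'"
  proof
    fix a assume "a \<in> A"
    then have "f a \<in> univ P" "?g (f a) = a" using P(2) subset_cl[of "f ` A" X] g_f A(1) by auto
    then show "a \<in> univ P'" unfolding isomorphism_univ[OF P'(1)] by (metis imageI)
  qed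
  then have MP: "univ M \<subseteq> ?g ` univ P"
    using cl_least[OF P'(2) AP] unfolding A(3) isomorphism_univ[OF P'(1)] by blast
  have "f x \<in> univ P" if x: "x \<in> univ M" for x
  proof -
    obtain p where "p \<in> univ P" "x = ?g p" using MP x by blast
    moreover have "p \<in> f ` univ M" using le_univ[OF PM] M'(3) calculation(1) by blast
    ultimately show ?thesis by (simp add: f_inv_into_f)
  qed
  then have "f ` univ M \<subseteq> c i ` univ (D i)" using P(2) cl_least[OF E(1) fA(2)] E(2) by auto
  then obtain g where "emb g M (D i)" "compose (univ M) (c i) g = f"
    using emb_factor[OF f c] by blast
  then show "\<exists>i\<in>I. \<exists>g. emb g M (D i) \<and> compose (univ M) (c i) g = f" using i(1) by blast
qed

text \<open>\<open>M\<close> is the \<open>\<kappa>\<close>-directed union of the closures of its subsets of size less than \<open>\<kappa>\<close>, so its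
  identity factors through one of them. The index poset lives on codes of these subsets.\<close>

lemma presentable_generated:
  assumes kappa: "regular_cardinal \<kappa>" "\<mu> \<le>o \<kappa>" and M: "M \<in> models K"
    and pres: "presentable \<kappa> (cat_of K) M"
  obtains A where "A \<subseteq> univ M" "|A| <o \<kappa>" "cl K M A = univ M"
proof -
  define S where "S = {A. A \<subseteq> univ M \<and> |A| <o \<kappa>}"
  have small_S: "|S| <o |UNIV :: 'u set|"
  proof -
    have "|S| \<le>o |Pow (univ M)|" by (rule card_of_mono1) (auto simp: S_def)
    also have "|Pow (univ M)| <o |UNIV :: 'u set|"
      using small_Pow[OF inaccessible] small_univ[OF M] by (simp add: small_def)
    finally show ?thesis .
  qed
  then obtain enc :: "'u set \<Rightarrow> 'u" where enc: "inj_on enc S"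
    using ordLess_imp_ordLeq[OF small_S] card_of_ordLeq[of S "UNIV :: 'u set"] by blast
  define I where "I = enc ` S"
  define dec where "dec = inv_into S enc"
  define r where "r = {(i, j). i \<in> I \<and> j \<in> I \<and> dec i \<subseteq> dec j}"
  have dec: "dec (enc A) = A" if "A \<in> S" for A using enc that by (simp add: dec_def)
  have decS: "dec i \<in> S" "enc (dec i) = i" if "i \<in> I" for i
    using that dec by (auto simp: I_def)
  have I: "small I" using ordLeq_ordLess_trans[OF card_of_image small_S] by (simp add: small_def I_def)
  have dir: "directed_poset \<kappa> I r"
    unfolding directed_poset_def
  proof (intro conjI allI impI)
    have "i = j" if "i \<in> I" "j \<in> I" "dec i = dec j" for i j using that decS(2) by metis
    then show "partial_order_on I r"
      by (auto simp: partial_order_on_def preorder_on_def refl_on_def r_def intro!: transI antisymI)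
    fix X assume X: "X \<subseteq> I" "|X| <o \<kappa>"
    \<comment> \<open>Regularity of \<open>\<kappa>\<close> keeps the union of the coded sets in
      \<open>S\<close>, and its code is the upper bound of \<open>X\<close>.\<close>
    have "|\<Union>i\<in>X. dec i| <o \<kappa>"
      using decS(1) X regular_cardinalD[OF kappa(1)]
      by (intro card_of_UNION_ordLess_infinite_Field_regularCard) (auto simp: S_def)
    then have B: "(\<Union>i\<in>X. dec i) \<in> S" using decS(1) X(1) by (fastforce simp: S_def)
    show "\<exists>u\<in>I. \<forall>x\<in>X. (x, u) \<in> r"
      by (rule bexI[of _ "enc (\<Union>i\<in>X. dec i)"]) (use B X(1) dec[OF B] in \<open>auto simp: I_def r_def\<close>)
  qed
  have "\<exists>P. le K P M \<and> univ P = cl K M A" if "A \<in> S" for A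
    by (rule cl_model[OF M, of A]) (use that in \<open>auto simp: S_def\<close>)
  then obtain P where P: "\<And>A. A \<in> S \<Longrightarrow> le K (P A) M" "\<And>A. A \<in> S \<Longrightarrow> univ (P A) = cl K M A"
    by metis
  let ?D = "\<lambda>i. P (dec i)"
  have DM: "le K (?D i) M" "univ (?D i) = cl K M (dec i)" if "i \<in> I" for i
    using P decS(1)[OF that] by auto
  have mono: "univ (?D i) \<subseteq> univ (?D j)" if "(i, j) \<in> r" for i j
    using that DM(2) cl_mono by (auto simp: r_def)
  have "univ M \<subseteq> (\<Union>i\<in>I. univ (?D i))"
  proof
    fix x assume x: "x \<in> univ M"
    then have S: "{x} \<in> S" using finite_ordLess_regular[OF kappa(1), of "{x}"] by (simp add: S_def)
    then have "enc {x} \<in> I" "x \<in> univ (?D (enc {x}))"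
      using P(2)[OF S] dec[OF S] subset_cl[of "{x}" M] by (auto simp: I_def)
    then show "x \<in> (\<Union>i\<in>I. univ (?D i))" by blast
  qed
  then have union: "univ M = (\<Union>i\<in>I. univ (?D i))" using le_univ[OF DM(1)] by blast
  note colim = union_colimit[OF directed_poset_mono[OF dir kappa(2)] I DM(1) mono M union]
  obtain i g where i: "i \<in> I" "emb g M (?D i)"
    "compose (univ M) (restrict id (univ (?D i))) g = restrict id (univ M)"
    using presentable_factor[OF pres I dir colim emb_inclusion[OF le_refl[OF M]]] by blast
  \<comment> \<open>The inclusion after \<open>g\<close> is the identity, so the stage
    \<open>?D i\<close> contains every element of \<open>M\<close>.\<close>
  have "x \<in> cl K M (dec i)" if "x \<in> univ M" for x
    using fun_cong[OF i(3), of x] that emb_mem[OF i(2) that] DM(2)[OF i(1)] by (simp add: compose_def)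
  moreover have "dec i \<subseteq> univ M" "|dec i| <o \<kappa>" using decS(1)[OF i(1)] by (auto simp: S_def)
  ultimately show thesis using cl_subset_univ[OF M] by (intro that[of "dec i"]) auto
qed

end

section \<open>Cardinal arithmetic\<close>

text \<open>Supplies the smallness that \<open>almost_closed\<close> and \<open>GCH\<close> require
  of the cardinals they are applied to.\<close>

lemma cardinal_card_of_ordLess:
  fixes B :: "'u set" and lam :: "'u rel"
  assumes "Card_order lam" "|B| <o lam"
  shows "cardinal |B|"
proof -
  have "lam =o |Field lam|" using assms(1) card_of_Field_ordIso ordIso_symmetric by blast
  then have "|B| <o |Field lam|" by (rule ordLess_ordIso_trans[OF assms(2)])
  also have "|Field lam| \<le>o |UNIV :: 'u set|" by (rule card_of_mono1) simp
  finally show ?thesis by (simp add: cardinal_def small_def Field_card_of card_of_card_order_on)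
qed

text \<open>\<open>SCH\<close> makes \<open>lam\<close> a limit: its test ordinals include those strictly between a cardinal of the
  unbounded set and \<open>lam\<close>.\<close>

lemma SCH_cpow_less:
  fixes B :: "'u set" and \<mu> lam :: "'u rel"
  assumes SCH: "SCH \<mu> lam" and lam: "Cinfinite lam" and B: "|B| <o lam"
  shows "cpow_less |B| \<mu> <o lam"
proof -
  have wo: "Well_order lam" using lam card_order_on_well_order_on by blast
  obtain S :: "'u rel set" where S: "\<And>\<chi>. \<chi> \<in> S \<Longrightarrow> cardinal \<chi> \<and> \<chi> <o lam"
    "\<And>\<alpha> :: 'u rel. Well_order \<alpha> \<Longrightarrow> \<alpha> <o lam \<Longrightarrow> \<exists>\<chi>\<in>S. \<alpha> \<le>o \<chi>"
    "\<And>\<chi>. \<chi> \<in> S \<Longrightarrow> almost_closed \<mu> \<chi>"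
    using SCH unfolding SCH_def by blast
  obtain a where a: "a \<in> Field lam" "|B| =o Restr lam (underS lam a)"
    using B ordLess_iff_ordIso_Restr[OF wo card_of_Well_order] by blast
  \<comment> \<open>\<open>a\<close> represents the ordinal of \<open>|B|\<close>. A later
    \<open>b\<close> exists because an infinite cardinal has no last element, and it forces
    \<open>\<chi>\<close> strictly above \<open>|B|\<close>; \<open>almost_closed\<close> bounds
    powers only of cardinals below \<open>\<chi>\<close>.\<close>
  obtain b where b: "b \<in> Field lam" "a \<noteq> b" "(a, b) \<in> lam"
    using infinite_Card_order_limit[of lam a] lam a(1) by (auto simp: cinfinite_def)
  let ?\<alpha> = "Restr lam (underS lam b)"
  have "underS lam a \<subset> underS lam b"
    using wo b underS_incr[of lam a b] by (auto simp: underS_def order_on_defs)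
  then have "Restr lam (underS lam a) <o ?\<alpha>"
    using ofilter_subset_ordLess[OF wo, of "underS lam a" "underS lam b"] wo
    by (simp add: wo_rel.underS_ofilter wo_rel_def)
  with a(2) have "|B| <o ?\<alpha>" by (rule ordIso_ordLess_trans)
  moreover have "Well_order ?\<alpha>" "?\<alpha> <o lam"
    using wo underS_Restr_ordLess[OF wo] a(1) Well_order_Restr by auto
  then obtain \<chi> where \<chi>: "\<chi> \<in> S" "?\<alpha> \<le>o \<chi>" using S(2) by blast
  ultimately have "|B| <o \<chi>" by (blast intro: ordLess_ordLeq_trans)
  then have "cpow_less |B| \<mu> \<le>o \<chi>"
    using S(3)[OF \<chi>(1)] cardinal_card_of_ordLess[of lam B] lam B by (simp add: almost_closed_def)
  then show ?thesis using S(1)[OF \<chi>(1)] by (blast intro: ordLeq_ordLess_trans)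
qed

text \<open>A function is coded by its domain and its graph. The graphs are subsets of a set of size
  at most \<open>\<nu>\<close>, so there are at most \<open>2^\<nu>\<close> codes, and GCH makes
  this the successor of \<open>\<nu>\<close>.\<close>

lemma GCH_cpow_less:
  fixes B :: "'u set" and \<mu> \<nu> :: "'u rel"
  assumes GCH: "GCH TYPE('u)" and \<nu>: "cardinal \<nu>" "infinite (Field \<nu>)"
    and \<mu>: "Card_order \<mu>" "\<mu> \<le>o \<nu>" and B: "|B| \<le>o \<nu>"
  shows "cpow_less |B| \<mu> \<le>o cardSuc \<nu>"
proof -
  let ?Z = "Field \<nu>"
  have co: "Card_order \<nu>" using \<nu>(1) by (simp add: cardinal_def)
  have M: "|Field \<mu>| \<le>o \<nu>"
    using ordIso_ordLeq_trans[OF card_of_Field_ordIso[OF \<mu>(1)] \<mu>(2)] .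
  let ?code = "\<lambda>(\<alpha>, f). (\<alpha>, (\<lambda>x. (x, f x)) ` underS \<mu> \<alpha>)"
  let ?D = "SIGMA \<alpha> : Field \<mu>. Func (underS \<mu> \<alpha>) B"
  have "inj_on ?code ?D"
  proof (rule inj_onI, clarsimp)
    fix \<alpha> f g
    assume f: "f \<in> Func (underS \<mu> \<alpha>) B" and g: "g \<in> Func (underS \<mu> \<alpha>) B"
      and eq: "(\<lambda>x. (x, f x)) ` underS \<mu> \<alpha> = (\<lambda>x. (x, g x)) ` underS \<mu> \<alpha>"
    show "f = g"
    proof
      fix x
      show "f x = g x"
      proof (cases "x \<in> underS \<mu> \<alpha>")
        case True
        then have "(x, f x) \<in> (\<lambda>x. (x, g x)) ` underS \<mu> \<alpha>" using eq by blast
        then show ?thesis by auto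
      qed (use f g in \<open>simp add: Func_def\<close>)
    qed
  qed
  moreover have "?code ` ?D \<subseteq> Field \<mu> \<times> Pow (Field \<mu> \<times> B)"
    by (auto simp: Func_def underS_def Field_def)
  ultimately have "|?D| \<le>o |Field \<mu> \<times> Pow (Field \<mu> \<times> B)|" using card_of_ordLeq by blast
  also have "|Field \<mu> \<times> Pow (Field \<mu> \<times> B)| \<le>o |Pow ?Z|"
  proof -
    have "|Field \<mu> \<times> B| \<le>o \<nu>"
      using card_of_Times_ordLeq_infinite_Field[OF \<nu>(2) M B co] .
    then have "|Field \<mu> \<times> B| \<le>o |?Z|"
      using ordLeq_ordIso_trans ordIso_symmetric[OF card_of_Field_ordIso[OF co]] by blast
    then obtain h where h: "inj_on h (Field \<mu> \<times> B)" "h ` (Field \<mu> \<times> B) \<subseteq> ?Z"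
      using card_of_ordLeq[of "Field \<mu> \<times> B" ?Z] by blast
    have "|Pow (Field \<mu> \<times> B)| \<le>o |Pow ?Z|"
      using inj_on_image_Pow[OF h(1)] image_Pow_mono[OF h(2)]
        card_of_ordLeq[of "Pow (Field \<mu> \<times> B)" "Pow ?Z"] by blast
    moreover have "|Field \<mu>| \<le>o |Pow ?Z|"
      using ordLeq_ordLess_trans[OF M Card_order_Pow[OF co]] by (rule ordLess_imp_ordLeq)
    ultimately show ?thesis
      using \<nu>(2) by (intro card_of_Times_ordLeq_infinite_Field) (auto simp: Field_card_of card_of_Card_order card_of_card_order_on)
  qed
  also have "|Pow ?Z| =o cardSuc \<nu>" using GCH \<nu> by (simp add: GCH_def)
  finally show ?thesis by (simp add: cpow_less_def Field_card_of)
qed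


section \<open>Models of prescribed internal size\<close>

context mu_aec_intersections
begin

text \<open>Generation by \<open>A\<close> bounds the presentability rank by the successor of
  \<open>lam\<close>; a rank of at most \<open>lam\<close> would give a generating set of size below
  \<open>lam\<close>, against minimality.\<close>

lemma internal_size_of_minimal_generation:
  assumes lam: "cardinal lam" "infinite (Field lam)" "\<mu> \<le>o lam"
    and N: "N \<in> models K" "cardSuc lam \<le>o |univ N|"
    and A: "A \<subseteq> univ N" "|A| \<le>o lam"
    and minimal: "\<And>B. B \<subseteq> univ N \<Longrightarrow> |B| <o lam \<Longrightarrow> cl K N B \<noteq> cl K N A"
  shows "\<exists>M\<in>models K. has_internal_size K M lam"
proof -
  obtain M where M: "le K M N" "univ M = cl K N A" using cl_model[OF N(1) A(1)] .
  note MK = le_models1[OF M(1)]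
  have AM: "A \<subseteq> univ M" using M(2) subset_cl by simp
  have co: "Card_order lam" using lam(1) by (simp add: cardinal_def)
  have cinf: "Cinfinite lam" using co lam(2) by (simp add: cinfinite_def)
  have cs: "Card_order (cardSuc lam)" by (rule cardSuc_Card_order[OF co])
  have "|Field (cardSuc lam)| \<le>o |univ N|"
    using ordIso_ordLeq_trans[OF card_of_Field_ordIso[OF cs] N(2)] .
  \<comment> \<open>\<open>cardSuc lam\<close> is an order on sets over \<open>'u\<close>, while
    ranks are orders on \<open>'u\<close>. The large model \<open>N\<close> contains a copy of it,
    which is small because \<open>N\<close> is.\<close>
  then obtain U where U: "U \<subseteq> univ N" "|Field (cardSuc lam)| =o |U|"
    using internalize_card_of_ordLeq2[of "Field (cardSuc lam)" "univ N"] by auto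
  have \<rho>: "cardSuc lam =o |U|"
    using ordIso_transitive[OF ordIso_symmetric[OF card_of_Field_ordIso[OF cs]] U(2)] .
  have regular: "regular_cardinal |U|"
  proof -
    have "small U"
      using ordLeq_ordLess_trans[OF card_of_mono1[OF U(1)]] small_univ[OF N(1)] by (simp add: small_def)
    moreover have "Cinfinite |U|" using Cinfinite_cong[OF \<rho> Cinfinite_cardSuc[OF cinf]] .
    moreover have "regularCard |U|"
      using regularCard_ordIso[OF \<rho> Cinfinite_cardSuc[OF cinf] regularCard_cardSuc[OF cinf]] .
    ultimately show ?thesis
      by (simp add: regular_cardinal_def cardinal_def cinfinite_def Field_card_of)
  qed
  have lam_less: "lam <o |U|" using ordLess_ordIso_trans[OF cardSuc_greater[OF co] \<rho>] .
  have "presentable |U| (cat_of K) M"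
  proof (rule generated_presentable[OF regular _ MK AM])
    show "\<mu> \<le>o |U|" using ordLess_imp_ordLeq[OF ordLeq_ordLess_trans[OF lam(3) lam_less]] .
    show "|A| <o |U|" using ordLeq_ordLess_trans[OF A(2) lam_less] .
    show "cl K M A = univ M" using cl_le[OF M(1) AM] M(2) by simp
  qed
  moreover have "|U| \<le>o \<kappa>" if \<kappa>: "regular_cardinal \<kappa>" "presentable \<kappa> (cat_of K) M" for \<kappa>
  proof (rule ccontr)
    note co\<kappa> = regular_cardinalD(1)[OF \<kappa>(1)] and co\<mu> = regular_cardinalD(1)[OF regular_mu]
    assume "\<not> |U| \<le>o \<kappa>"
    then have "\<kappa> <o |U|"
      using co\<kappa> card_of_Well_order card_order_on_well_order_on not_ordLeq_iff_ordLess by blast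
    then have "\<kappa> <o cardSuc lam" by (rule ordLess_ordIso_trans[OF _ ordIso_symmetric[OF \<rho>]])
    then have le: "\<kappa> \<le>o lam" using cardSuc_ordLeq_ordLess[OF co co\<kappa>] by simp
    \<comment> \<open>Passing from presentability to generators requires a cardinal of at least
      \<open>\<mu>\<close>; the larger of \<open>\<kappa>\<close> and \<open>\<mu>\<close> is still
      at most \<open>lam\<close>.\<close>
    obtain \<kappa>' :: "'u rel" where \<kappa>': "regular_cardinal \<kappa>'" "\<mu> \<le>o \<kappa>'" "\<kappa> \<le>o \<kappa>'" "\<kappa>' \<le>o lam"
    proof (cases "\<mu> \<le>o \<kappa>")
      case True
      then show thesis using that[of \<kappa>] \<kappa>(1) le co\<kappa> ordLeq_refl by blast
    next
      case False
      then have "\<kappa> \<le>o \<mu>"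
        using co\<kappa> co\<mu> card_order_on_well_order_on not_ordLeq_iff_ordLess ordLess_imp_ordLeq by blast
      then show thesis using that[of \<mu>] regular_mu lam(3) co\<mu> ordLeq_refl by blast
    qed
    obtain B where B: "B \<subseteq> univ M" "|B| <o \<kappa>'" "cl K M B = univ M"
      using presentable_generated[OF \<kappa>'(1,2) MK presentable_mono[OF \<kappa>(2) \<kappa>'(3)]] .
    have "B \<subseteq> univ N" using B(1) le_univ[OF M(1)] by blast
    moreover have "|B| <o lam" using ordLess_ordLeq_trans[OF B(2) \<kappa>'(4)] .
    moreover have "cl K N B = cl K N A" using cl_le[OF M(1) B(1)] B(3) M(2) by simp
    ultimately show False using minimal by blast
  qed
  ultimately have "has_presentability_rank K M |U|"
    using regular by (simp add: has_presentability_rank_def)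
  then have "has_internal_size K M lam"
    unfolding has_internal_size_def using lam(1) ordIso_symmetric[OF \<rho>] by blast
  then show ?thesis using MK by blast
qed

text \<open>Any \<open>A\<close> of size exactly \<open>lam\<close> works: its closure is too large
  to be the closure of a smaller set.\<close>

lemma minimal_generation_of_small_closures:
  assumes N: "N \<in> models K" and lam: "Card_order lam" "lam \<le>o |univ N|"
    and small: "\<And>B. B \<subseteq> univ N \<Longrightarrow> |B| <o lam \<Longrightarrow> |cl K N B| <o lam"
  obtains A where "A \<subseteq> univ N" "|A| \<le>o lam"
    "\<And>B. B \<subseteq> univ N \<Longrightarrow> |B| <o lam \<Longrightarrow> cl K N B \<noteq> cl K N A"
proof -
  have "|Field lam| \<le>o |univ N|"
    using ordIso_ordLeq_trans[OF card_of_Field_ordIso[OF lam(1)] lam(2)] .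
  then obtain A where A: "A \<subseteq> univ N" "|Field lam| =o |A|"
    using internalize_card_of_ordLeq2[of "Field lam" "univ N"] by auto
  have eq: "|A| =o lam"
    using ordIso_transitive[OF ordIso_symmetric[OF A(2)] card_of_Field_ordIso[OF lam(1)]] .
  show thesis
  proof (rule that[OF A(1) ordIso_imp_ordLeq[OF eq]])
    fix B assume B: "B \<subseteq> univ N" "|B| <o lam"
    show "cl K N B \<noteq> cl K N A"
    proof
      assume "cl K N B = cl K N A"
      then have "|A| \<le>o |cl K N B|" using card_of_mono1[OF subset_cl[of A N]] by simp
      then have "|A| <o lam" using small[OF B] by (rule ordLeq_ordLess_trans)
      then show False using eq not_ordLess_ordIso[of "|A|" lam] by blast
    qed
  qed
qed

text \<open>Choose \<open>a\<^sub>i\<close> outside the closure of its predecessors, for \<open>i < lam\<close>. By regularity a set of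
  fewer than \<open>lam\<close> elements of the generated model lies in the closure of some initial segment.\<close>

lemma minimal_generation_of_regular:
  fixes lam :: "'u rel"
  assumes N: "N \<in> models K" and lam: "cardinal lam" "infinite (Field lam)" "regularCard lam" "\<mu> \<le>o lam"
    and proper: "\<And>B. B \<subseteq> univ N \<Longrightarrow> |B| <o lam \<Longrightarrow> cl K N B \<noteq> univ N"
  obtains A where "A \<subseteq> univ N" "|A| \<le>o lam"
    "\<And>B. B \<subseteq> univ N \<Longrightarrow> |B| <o lam \<Longrightarrow> cl K N B \<noteq> cl K N A"
proof -
  have co: "Card_order lam" using lam(1) by (simp add: cardinal_def)
  have wo: "Well_order lam" by (rule card_order_on_well_order_on[OF co])
  have wf: "wf (lam - Id)" and trans: "trans lam" and antisym: "antisym lam" and refl: "Refl lam"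
    using wo by (simp_all add: order_on_defs)
  have "\<exists>f. \<forall>i. i \<in> Field lam \<longrightarrow> f i \<in> univ N \<and> f i \<notin> cl K N (f ` underS lam i)"
  proof (rule dependent_wf_choice[OF wf, of "\<lambda>f i y. i \<in> Field lam \<longrightarrow> y \<in> univ N \<and> y \<notin> cl K N (f ` underS lam i)"])
    fix f g :: "'u \<Rightarrow> 'u" and i y
    assume "\<And>j. (j, i) \<in> lam - Id \<Longrightarrow> f j = g j"
    then have "f ` underS lam i = g ` underS lam i" by (intro image_cong) (auto simp: underS_def)
    then show "(i \<in> Field lam \<longrightarrow> y \<in> univ N \<and> y \<notin> cl K N (f ` underS lam i)) =
        (i \<in> Field lam \<longrightarrow> y \<in> univ N \<and> y \<notin> cl K N (g ` underS lam i))"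
      by simp
  next
    fix i and f :: "'u \<Rightarrow> 'u"
    assume f: "\<And>j. (j, i) \<in> lam - Id \<Longrightarrow> j \<in> Field lam \<longrightarrow> f j \<in> univ N \<and> f j \<notin> cl K N (f ` underS lam j)"
    show "\<exists>y. i \<in> Field lam \<longrightarrow> y \<in> univ N \<and> y \<notin> cl K N (f ` underS lam i)"
    proof (cases "i \<in> Field lam")
      case True
      have sub: "f ` underS lam i \<subseteq> univ N" using f by (auto simp: underS_def Field_def)
      \<comment> \<open>A proper initial segment of a cardinal is smaller than it, so the closure of
        the earlier values is proper and a new value is left to choose.\<close>
      have "|f ` underS lam i| <o lam"
        using ordLeq_ordLess_trans[OF card_of_image card_of_underS[OF co True]] .
      then show ?thesis using proper[OF sub] cl_subset_univ[OF N sub] by blast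
    qed simp
  qed
  then obtain f where f: "\<And>i. i \<in> Field lam \<Longrightarrow> f i \<in> univ N"
    "\<And>i. i \<in> Field lam \<Longrightarrow> f i \<notin> cl K N (f ` underS lam i)"
    by blast
  let ?C = "\<lambda>i. cl K N (f ` underS lam i)"
  have sub: "f ` underS lam i \<subseteq> univ N" for i using f(1) by (auto simp: underS_def Field_def)
  have "\<exists>P. le K P N \<and> univ P = ?C i" for i by (rule cl_model[OF N sub]) blast
  then obtain P where P: "\<And>i. le K (P i) N" "\<And>i. univ (P i) = ?C i" by metis
  have mono: "?C i \<subseteq> ?C j" if "(i, j) \<in> lam" for i j
    by (intro cl_mono image_mono underS_incr[OF trans antisym that])
  \<comment> \<open>Regularity makes the order \<open>lam\<close> itself
    \<open>\<mu>\<close>-directed, so the union of the increasing closures is again a submodel of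
    \<open>N\<close>.\<close>
  have dir: "directed_poset \<mu> (Field lam) lam"
    unfolding directed_poset_def
  proof (intro conjI allI impI)
    show "partial_order_on (Field lam) lam" using wo by (simp add: order_on_defs)
    fix X assume X: "X \<subseteq> Field lam" "|X| <o \<mu>"
    have "\<exists>i\<in>Field lam. X \<subseteq> under lam i"
    proof (rule regularCard_UNION[OF co lam(3)])
      show "relChain lam (under lam)" using under_incr[OF trans] by (simp add: relChain_def)
      show "X \<subseteq> (\<Union>i\<in>Field lam. under lam i)"
        using X(1) refl by (auto simp: under_def refl_on_def)
      show "|X| <o lam" using ordLess_ordLeq_trans[OF X(2) lam(4)] .
    qed
    then show "\<exists>u\<in>Field lam. \<forall>x\<in>X. (x, u) \<in> lam" by (auto simp: under_def)
  qed
  have small: "small (Field lam)" using lam(1) by (simp add: cardinal_def)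
  obtain U where U: "le K U N" "univ U = (\<Union>i\<in>Field lam. univ (P i))"
    by (rule union_le[where M = P, OF small dir P(1) _ N]) (use mono P(2) in auto)
  let ?A = "f ` Field lam"
  have AU: "?A \<subseteq> univ U"
  proof
    fix a assume "a \<in> ?A"
    then obtain i where i: "i \<in> Field lam" "a = f i" by blast
    \<comment> \<open>The stage at \<open>i\<close> uses only predecessors of \<open>i\<close>;
      since \<open>lam\<close> has no last element, \<open>f i\<close> enters at a later
      stage.\<close>
    then obtain j where "j \<in> Field lam" "i \<noteq> j" "(i, j) \<in> lam"
      using infinite_Card_order_limit[OF co lam(2)] by blast
    then have "a \<in> ?C j" using i subset_cl[of "f ` underS lam j" N] by (auto simp: underS_def)
    then show "a \<in> univ U" using U(2) P(2) \<open>j \<in> Field lam\<close> by blast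
  qed
  show thesis
  proof (rule that[of ?A])
    show "?A \<subseteq> univ N" using f(1) by blast
    show "|?A| \<le>o lam"
      using ordLeq_ordIso_trans[OF card_of_image card_of_Field_ordIso[OF co]] .
    fix B assume B: "B \<subseteq> univ N" "|B| <o lam"
    show "cl K N B \<noteq> cl K N ?A"
    proof
      assume eq: "cl K N B = cl K N ?A"
      have "\<exists>i\<in>Field lam. B \<subseteq> ?C i"
      proof (rule regularCard_UNION[OF co lam(3) _ _ B(2)])
        show "relChain lam ?C" using mono by (simp add: relChain_def)
        show "B \<subseteq> (\<Union>i\<in>Field lam. ?C i)"
          using subset_cl[of B N] cl_least[OF U(1) AU] eq U(2) P(2) by simp
      qed
      then obtain i where i: "i \<in> Field lam" "B \<subseteq> ?C i" by blast
      then have "cl K N B \<subseteq> ?C i" using cl_least[OF P(1), of B i] P(2) by simp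
      then have "f i \<in> ?C i" using eq subset_cl[of ?A N] i(1) by blast
      then show False using f(2)[OF i(1)] by blast
    qed
  qed
qed

text \<open>The closure lies inside every submodel containing \<open>B\<close>, in particular inside
  one given by the Loewenheim-Skolem-Tarski axiom.\<close>

lemma card_cl:
  assumes "LST_cardinal \<mu> K LS" "N \<in> models K" "B \<subseteq> univ N"
  shows "|cl K N B| \<le>o cpow_less |B| \<mu> +c LS"
proof -
  obtain M0 where M0: "le K M0 N" "B \<subseteq> univ M0" "|univ M0| \<le>o cpow_less |B| \<mu> +c LS"
    using assms unfolding LST_cardinal_def by blast
  show ?thesis by (rule ordLeq_transitive[OF card_of_mono1[OF cl_least[OF M0(1,2)]] M0(3)])
qed

end

section \<open>Case distinction on the cardinal hypotheses\<close>

theorem theorem5p8: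
  fixes \<mu> LS lam :: "'u rel" and K :: "'u aclass"
  assumes "inaccessible_type TYPE('u)"
    and "regular_cardinal \<mu>"
    and "mu_AEC \<mu> K"
    and "admits_intersections K"
    and "is_LS \<mu> K LS"
    and "cardinal lam"
    and "LS <o lam"
    and "GCH TYPE('u) \<or> SCH \<mu> lam"
    and "\<exists>N\<in>models K. cardSuc lam \<le>o |univ N|"
  shows "\<exists>M\<in>models K. has_internal_size K M lam"
proof -
  interpret mu_aec_intersections \<mu> K
    using assms by unfold_locales
  obtain N where N: "N \<in> models K" "cardSuc lam \<le>o |univ N|" using assms(9) by blast
  have LST: "LST_cardinal \<mu> K LS" using assms(5) by (simp add: is_LS_def)
  then have cLS: "cardinal LS" and "|syms (voc K)| +c \<mu> \<le>o LS" by (simp_all add: LST_cardinal_def)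
  note co\<mu> = regular_cardinalD(1)[OF assms(2)]
  have \<mu>LS: "\<mu> \<le>o LS" using ordLeq_transitive[OF ordLeq_csum2[OF co\<mu>]] \<open>|syms (voc K)| +c \<mu> \<le>o LS\<close> .
  have coLS: "Card_order LS" and co: "Card_order lam" using cLS assms(6) by (simp_all add: cardinal_def)
  have cinfLS: "Cinfinite LS" using cinfinite_mono[OF \<mu>LS] regular_cardinalD(2)[OF assms(2)] coLS by simp
  have cinf: "Cinfinite lam"
    using cinfinite_mono[OF ordLess_imp_ordLeq[OF assms(7)]] cinfLS co by simp
  then have inf: "infinite (Field lam)" by (simp add: cinfinite_def)
  have \<mu>lam: "\<mu> \<le>o lam" using ordLeq_transitive[OF \<mu>LS ordLess_imp_ordLeq[OF assms(7)]] .
  have lamN: "lam \<le>o |univ N|" using ordLeq_transitive[OF cardSuc_ordLeq[OF co] N(2)] .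
  note result = internal_size_of_minimal_generation[OF assms(6) inf \<mu>lam N]
  show ?thesis
  proof (cases "SCH \<mu> lam")
    case True
    \<comment> \<open>Both summands of the bound on closures are below the infinite cardinal
      \<open>lam\<close>, hence so is their sum.\<close>
    have "|cl K N B| <o lam" if B: "B \<subseteq> univ N" "|B| <o lam" for B
    proof -
      have "|Field (cpow_less |B| \<mu>)| <o lam"
        using SCH_cpow_less[OF True cinf B(2)] by (simp add: cpow_less_def Field_card_of)
      moreover have "|Field LS| <o lam"
        using ordIso_ordLess_trans[OF card_of_Field_ordIso[OF coLS] assms(7)] .
      ultimately have "cpow_less |B| \<mu> +c LS <o lam"
        unfolding csum_def by (rule card_of_Plus_ordLess_infinite_Field[OF inf co])
      then show ?thesis by (rule ordLeq_ordLess_trans[OF card_cl[OF LST N(1) B(1)]])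
    qed
    then show ?thesis using minimal_generation_of_small_closures[OF N(1) co lamN] result by metis
  next
    case False
    then have GCH: "GCH TYPE('u)" using assms(8) by blast
    have bound: "\<exists>\<nu> :: 'u rel. Cinfinite \<nu> \<and> \<nu> <o lam \<and> |cl K N B| \<le>o cardSuc \<nu>"
      if B: "B \<subseteq> univ N" "|B| <o lam" for B
    proof -
      \<comment> \<open>\<open>\<nu>\<close> is the larger of \<open>|B|\<close> and
        \<open>LS\<close>, both of which are below \<open>lam\<close>.\<close>
      obtain \<nu> :: "'u rel" where \<nu>: "cardinal \<nu>" "\<nu> <o lam" "|B| \<le>o \<nu>" "LS \<le>o \<nu>"
      proof (cases "|B| \<le>o LS")
        case True
        then show thesis using that[of LS] cLS assms(7) ordLeq_refl[OF coLS] by blast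
      next
        case False
        then have "LS \<le>o |B|"
          using card_of_Well_order card_order_on_well_order_on[OF coLS] not_ordLeq_iff_ordLess
            ordLess_imp_ordLeq by blast
        then show thesis
          using that[of "|B|"] cardinal_card_of_ordLess[OF co B(2)] B(2) ordLeq_refl[OF card_of_Card_order] by blast
      qed
      have co\<nu>: "Card_order \<nu>" using \<nu>(1) by (simp add: cardinal_def)
      have cinf\<nu>: "Cinfinite \<nu>" using cinfinite_mono[OF \<nu>(4)] cinfLS co\<nu> by simp
      have "cpow_less |B| \<mu> \<le>o cardSuc \<nu>"
        using cinf\<nu> by (intro GCH_cpow_less[OF GCH \<nu>(1) _ co\<mu> ordLeq_transitive[OF \<mu>LS \<nu>(4)] \<nu>(3)])
          (simp add: cinfinite_def)
      moreover have "LS \<le>o cardSuc \<nu>" using ordLeq_transitive[OF \<nu>(4) cardSuc_ordLeq[OF co\<nu>]] .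
      ultimately have "cpow_less |B| \<mu> +c LS \<le>o cardSuc \<nu>"
        by (rule csum_cinfinite_bound[OF _ _ _ coLS Cinfinite_cardSuc[OF cinf\<nu>]])
          (simp add: cpow_less_def card_of_Card_order)
      then have "|cl K N B| \<le>o cardSuc \<nu>" by (rule ordLeq_transitive[OF card_cl[OF LST N(1) B(1)]])
      then show ?thesis using \<nu>(2) cinf\<nu> by blast
    qed
    show ?thesis
    proof (cases "regularCard lam")
      case True
      \<comment> \<open>Otherwise the size of \<open>N\<close> would give
        \<open>cardSuc lam \<le>o cardSuc \<nu> \<le>o lam\<close>.\<close>
      have "cl K N B \<noteq> univ N" if B: "B \<subseteq> univ N" "|B| <o lam" for B
      proof
        assume eq: "cl K N B = univ N"
        obtain \<nu> :: "'u rel" where \<nu>: "Cinfinite \<nu>" "\<nu> <o lam" "|univ N| \<le>o cardSuc \<nu>"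
          using bound[OF B] eq by auto
        have "cardSuc \<nu> \<le>o lam" using cardSuc_ordLess_ordLeq[of \<nu> lam] \<nu>(1,2) co by simp
        then have "cardSuc lam \<le>o lam"
          by (rule ordLeq_transitive[OF ordLeq_transitive[OF N(2) \<nu>(3)]])
        then show False using cardSuc_greater[OF co] not_ordLess_ordLeq[of lam "cardSuc lam"] by blast
      qed
      then show ?thesis
        using minimal_generation_of_regular[OF N(1) assms(6) inf True \<mu>lam] result by metis
    next
      case False
      have "|cl K N B| <o lam" if B: "B \<subseteq> univ N" "|B| <o lam" for B
      proof -
        obtain \<nu> :: "'u rel" where \<nu>: "Cinfinite \<nu>" "\<nu> <o lam" "|cl K N B| \<le>o cardSuc \<nu>"
          using bound[OF B] by blast
        have "cardSuc \<nu> \<le>o lam" using cardSuc_ordLess_ordLeq[of \<nu> lam] \<nu>(1,2) co by simp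
        \<comment> \<open>Infinite successor cardinals are regular, so the singular
          \<open>lam\<close> is not one and the bound becomes strict.\<close>
        moreover have "\<not> cardSuc \<nu> =o lam"
          using regularCard_ordIso Cinfinite_cardSuc[OF \<nu>(1)] regularCard_cardSuc[OF \<nu>(1)] False by blast
        ultimately have "cardSuc \<nu> <o lam" using ordLeq_iff_ordLess_or_ordIso by blast
        then show ?thesis by (rule ordLeq_ordLess_trans[OF \<nu>(3)])
      qed
      then show ?thesis using minimal_generation_of_small_closures[OF N(1) co lamN] result by metis
    qed
  qed
qed

end
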